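(* Let $A$ be an $n$-by-$n$ complex matrix with $a(A)\ge 1$, let $\ell\ge 1$ be an integer, and let $k=\min\{\ell,a(A)\}$. Then the following conditions are equivalent: (a) $A,A^2,\ldots,A^k$ are partial isometries. (b) $A$ is unitarily similar to a matrix of the form $$A'=\left[\begin{array}{ccccc} 0 & A_1 & & & \\ & 0 & \ddots & & \\ & & \ddots & A_{k-1} & \\ & & & 0 & B\\ & & & & C\end{array}\right]\quad\text{on } \mathbb{C}^n=\mathbb{C}^{n_1}\oplus\cdots\oplus\mathbb{C}^{n_k}\oplus\mathbb{C}^{m},$$ where the $A_j$'s satisfy $A_j^*A_j=I_{n_{j+1}}$ for $1\le j\le k-1$, and $B$ and $C$ satisfy $B^*B+C^*C=I_m$. In this case, $n_1=\dim\ker A$, $n_j=\dim\ker A^j-\dim\ker A^{j-1}$ for $2\le j\le k$, and $m=\operatorname{rank}A^k$. (c) $A$ is unitarily similar to a matrix of the form $$A''=\left[\begin{array}{ccccc} 0 & I & & & \\ & 0 & \ddots & & \\ & & \ddots & I & \\ & & & 0 & B\\ & & & & C\end{array}\right]\oplus(\underbrace{J_{k-1}\oplus\cdots\oplus J_{k-1}}_{n_{k-1}-n_k})\oplus\cdots\oplus(\underbrace{J_1\oplus\cdots\oplus J_1}_{n_1-n_2})$$ on $$\mathbb{C}^n=\underbrace{\mathbb{C}^{n_k}\oplus\cdots\oplus\mathbb{C}^{n_k}}_{k}\oplus\mathbb{C}^{m}\oplus\underbrace{\mathbb{C}^{k-1}\oplus\cdots\oplus\mathbb{C}^{k-1}}_{n_{k-1}-n_k}\oplus\cdots\oplus\underbrace{\mathbb{C}\oplus\cdots\oplus\mathbb{C}}_{n_1-n_2},$$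 where $n_1=\dim\ker A$, $n_j=\dim\ker A^j-\dim\ker A^{j-1}$ for $2\le j\le k$, $m=\operatorname{rank}A^k$, and $B$ and $C$ satisfy $B^*B+C^*C=I_m$.
   Context: An $n$-by-$n$ complex matrix $A$ is a partial isometry if $\|Ax\|=\|x\|$ for every $x\in(\ker A)^\perp$ (standard norm on $\mathbb{C}^n$). The ascent $a(A)$ is the minimal integer $k\ge 0$ with $\ker A^k=\ker A^{k+1}$ (where $A^0=I_n$). $I_n$ is the $n$-by-$n$ identity matrix; $I$ and $0$ denote identity and zero matrices of the appropriate size; blank blocks are zero. $J_j$ is the $j$-by-$j$ nilpotent Jordan block, with $1$'s on the first superdiagonal and $0$'s elsewhere. In the block matrices, $A_j$ is $n_j$-by-$n_{j+1}$, $B$ is $n_k$-by-$m$ and $C$ is $m$-by-$m$; $m=0$ is allowed, in which case the blocks $B$ and $C$ are absent. In (c) the first summand has $k$ zero diagonal blocks of size $n_k$ followed by the block $C$, and for each $1\le j\le k-1$ there are $n_j-n_{j+1}$ copies of $J_j$ (possibly none). *)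

theory Defs
  imports
    Jordan_Normal_Form.Jordan_Normal_Form
    Jordan_Normal_Form.Schur_Decomposition
    Jordan_Normal_Form.Matrix_Kernel
    Jordan_Normal_Form.DL_Rank
begin

definition vec_l2norm :: "complex vec \<Rightarrow> real" where
  "vec_l2norm v = sqrt (\<Sum>i<dim_vec v. (cmod (v $ i))\<^sup>2)"

text \<open>The orthogonality is with respect to the sesquilinear product \<open>\<bullet>c\<close>; the library's
  \<open>orthogonal_complement\<close> uses the bilinear one and is not the complement in \<open>\<complex>\<^sup>n\<close>.\<close>

definition ker_perp :: "complex mat \<Rightarrow> complex vec set" where
  "ker_perp A = {x \<in> carrier_vec (dim_col A). \<forall>y \<in> mat_kernel A. x \<bullet>c y = 0}"

definition partial_isometry :: "complex mat \<Rightarrow> bool" where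
  "partial_isometry A \<longleftrightarrow> (\<forall>x \<in> ker_perp A. vec_l2norm (A *\<^sub>v x) = vec_l2norm x)"

definition ascent :: "complex mat \<Rightarrow> nat" where
  "ascent A = (LEAST k. mat_kernel (A ^\<^sub>m k) = mat_kernel (A ^\<^sub>m (k + 1)))"

definition unitary_similar :: "complex mat \<Rightarrow> complex mat \<Rightarrow> bool" where
  "unitary_similar A B \<longleftrightarrow> (\<exists>U. similar_mat_wit A B U (mat_adjoint U))"

text \<open>\<open>superdiag_mat [X\<^sub>1, \<dots>, X\<^sub>k] C\<close> is the block matrix whose diagonal blocks are
  \<open>k\<close> square zero blocks followed by \<open>C\<close>, whose first block superdiagonal is
  \<open>X\<^sub>1, \<dots>, X\<^sub>k\<close>, and whose other blocks are zero. The \<open>i\<close>-th zero block has size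
  \<open>dim_row X\<^sub>i\<close>; the shapes are meant to fit, i.e. \<open>dim_col X\<^sub>i = dim_row X\<^sub>i\<^sub>+\<^sub>1\<close> and
  \<open>dim_col X\<^sub>k = dim_row C\<close>. The matrix is built from the lower right corner, the first
  block row being \<open>0, X\<^sub>1, 0, \<dots>, 0\<close>.\<close>

definition pad_cols :: "nat \<Rightarrow> complex mat \<Rightarrow> complex mat" where
  "pad_cols c X = mat (dim_row X) c (\<lambda>(i, j). if j < dim_col X then X $$ (i, j) else 0)"

fun superdiag_mat :: "complex mat list \<Rightarrow> complex mat \<Rightarrow> complex mat" where
  "superdiag_mat [] C = C"
| "superdiag_mat (X # Xs) C =
    (let T = superdiag_mat Xs C
     in four_block_mat
          (0\<^sub>m (dim_row X) (dim_row X))  (pad_cols (dim_col T) X)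
          (0\<^sub>m (dim_row T) (dim_row X))  T)"

lemma superdiag_mat_carrier:
  assumes "C \<in> carrier_mat m m"
  shows "superdiag_mat Xs C \<in>
    carrier_mat (sum_list (map dim_row Xs) + m) (sum_list (map dim_row Xs) + m)"
  using assms by (induction Xs) (auto simp: Let_def)

lemma superdiag_mat_single:
  assumes "B \<in> carrier_mat r m" "C \<in> carrier_mat m m"
  shows "superdiag_mat [B] C = four_block_mat (0\<^sub>m r r) B (0\<^sub>m m r) C"
  using assms by (auto simp: Let_def pad_cols_def intro!: eq_matI)

text \<open>The sequences below are indexed from 1: \<open>d 1, \<dots>, d k\<close> are the block sizes
  \<open>n\<^sub>1, \<dots>, n\<^sub>k\<close>, and \<open>As 1, \<dots>, As (k - 1)\<close> are the blocks \<open>A\<^sub>1, \<dots>, A\<^sub>k\<^sub>-\<^sub>1\<close>.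
  The natural-number subtraction never truncates, as \<open>ker A\<^sup>j\<^sup>-\<^sup>1 \<subseteq> ker A\<^sup>j\<close>.\<close>

definition kernel_block_sizes :: "complex mat \<Rightarrow> nat \<Rightarrow> (nat \<Rightarrow> nat) \<Rightarrow> nat \<Rightarrow> bool" where
  "kernel_block_sizes A k d m \<longleftrightarrow>
     d 1 = kernel_dim A \<and>
     (\<forall>j \<in> {2..k}. d j = kernel_dim (A ^\<^sub>m j) - kernel_dim (A ^\<^sub>m (j - 1))) \<and>
     m = vec_space.rank (dim_row A) (A ^\<^sub>m k)"

definition isometric_block_form ::
  "complex mat \<Rightarrow> nat \<Rightarrow> (nat \<Rightarrow> nat) \<Rightarrow> nat \<Rightarrow> (nat \<Rightarrow> complex mat) \<Rightarrow>
     complex mat \<Rightarrow> complex mat \<Rightarrow> bool" where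
  "isometric_block_form A k d m As B C \<longleftrightarrow>
     dim_row A = (\<Sum>j=1..k. d j) + m \<and>
     (\<forall>j \<in> {1..k-1}. As j \<in> carrier_mat (d j) (d (j + 1)) \<and>
                       mat_adjoint (As j) * As j = 1\<^sub>m (d (j + 1))) \<and>
     B \<in> carrier_mat (d k) m \<and> C \<in> carrier_mat m m \<and>
     mat_adjoint B * B + mat_adjoint C * C = 1\<^sub>m m \<and>
     unitary_similar A (superdiag_mat (map As [1..<k] @ [B]) C)"

text \<open>The subtraction \<open>d j - d (j + 1)\<close> does not truncate either: the increments
  \<open>dim ker A\<^sup>j - dim ker A\<^sup>j\<^sup>-\<^sup>1\<close> are nonincreasing in \<open>j\<close> for every square matrix \<open>A\<close>.\<close>

definition jordan_block_form ::
  "complex mat \<Rightarrow> nat \<Rightarrow> (nat \<Rightarrow> nat) \<Rightarrow> nat \<Rightarrow> complex mat \<Rightarrow> complex mat \<Rightarrow> bool" where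
  "jordan_block_form A k d m B C \<longleftrightarrow>
     kernel_block_sizes A k d m \<and>
     dim_row A = k * d k + m + (\<Sum>j=1..k-1. (d j - d (j + 1)) * j) \<and>
     B \<in> carrier_mat (d k) m \<and> C \<in> carrier_mat m m \<and>
     mat_adjoint B * B + mat_adjoint C * C = 1\<^sub>m m \<and>
     unitary_similar A
       (diag_block_mat
         (superdiag_mat (replicate (k - 1) (1\<^sub>m (d k)) @ [B]) C #
          concat (map (\<lambda>j. replicate (d j - d (j + 1)) (jordan_block j 0)) (rev [1..<k]))))"

end

theory Submission
  imports Defs
begin

text \<open>
  If \<open>A, \<dots>, A\<^sup>k\<close> are partial isometries, then \<open>A\<close> maps \<open>(ker A\<^sup>j\<^sup>+\<^sup>1)\<^sup>\<bottom>\<close> into \<open>(ker A\<^sup>j)\<^sup>\<bottom>\<close> for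
  \<open>j < k\<close>. Hence \<open>A\<close> maps each layer \<open>ker A\<^sup>j\<^sup>+\<^sup>1 \<ominus> ker A\<^sup>j\<close>, \<open>1 \<le> j < k\<close>, isometrically into the
  layer below it, which is form (b) for orthonormal bases of the layers. Form (c) comes from
  orthonormal bases that are pushed down the layers and extended in each of them: every vector
  added in layer \<open>j\<close> is the top of an orthonormal Jordan chain of length \<open>j\<close>.

  Conversely, in both forms the basis vectors carry levels in \<open>{0, \<dots>, k}\<close> such that \<open>A\<close> lowers
  the level by one (or keeps the level \<open>k\<close>) and is isometric on the span of the positive levels.
  So \<open>ker A\<^sup>j\<close> is the span of the levels below \<open>j\<close>, and \<open>A\<^sup>j\<close> is isometric on the other levels.
\<close>

section \<open>Orthonormal lists in \<open>\<complex>\<^sup>n\<close>\<close>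

text \<open>A matrix is unitarily similar to \<open>A\<close> exactly if it represents
  \<open>A\<close> in some orthonormal basis, so both forms are statements about bases. Completeness
  of a list is tested by orthogonal vectors and lengths are compared by Bessel's inequality, so
  linear spans enter only for kernel dimension and rank.

  The obstacle in form (c) is the orthogonality of different chains. On the complement of its kernel
  \<open>A^a\<close> preserves inner products, so a common power of \<open>A\<close> can be stripped
  off two chain vectors. What remains is a pair of tops, or a top against a vector of another layer
  or an image from the layer above, and tops are chosen orthogonal to such images. That the chains
  fill the space is then a count: the drop of dimension between neighbouring layers is the number of
  new tops.

  In the converse nothing is known about the powers of \<open>C\<close>. Giving its whole summand
  the single level \<open>k\<close> hides it: no power up to \<open>A^k\<close> has to be analysed
  inside it.\<close>

lemma cscalar_prod_add_left:
  fixes x y z :: "complex vec"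
  assumes "x \<in> carrier_vec n" "y \<in> carrier_vec n" "z \<in> carrier_vec n"
  shows "(x + y) \<bullet>c z = x \<bullet>c z + y \<bullet>c z"
  using assms by (intro add_scalar_prod_distrib[where n = n]) auto

lemma cscalar_prod_add_right:
  fixes x y z :: "complex vec"
  assumes "x \<in> carrier_vec n" "y \<in> carrier_vec n" "z \<in> carrier_vec n"
  shows "x \<bullet>c (y + z) = x \<bullet>c y + x \<bullet>c z"
  using assms by (simp add: conjugate_add_vec[where n = n] scalar_prod_add_distrib[where n = n])

lemma cscalar_prod_smult_left:
  fixes x y :: "complex vec"
  assumes "x \<in> carrier_vec n" "y \<in> carrier_vec n"
  shows "(a \<cdot>\<^sub>v x) \<bullet>c y = a * (x \<bullet>c y)"
  using assms by simp

lemma cscalar_prod_smult_right: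
  fixes x y :: "complex vec"
  assumes "x \<in> carrier_vec n" "y \<in> carrier_vec n"
  shows "x \<bullet>c (a \<cdot>\<^sub>v y) = cnj a * (x \<bullet>c y)"
  using assms by (simp add: conjugate_smult_vec)

lemma cscalar_prod_minus_left:
  fixes x y z :: "complex vec"
  assumes "x \<in> carrier_vec n" "y \<in> carrier_vec n" "z \<in> carrier_vec n"
  shows "(x - y) \<bullet>c z = x \<bullet>c z - y \<bullet>c z"
  using assms by (intro minus_scalar_prod_distrib[where n = n]) auto

lemma cscalar_prod_commute:
  fixes x y :: "complex vec"
  assumes "x \<in> carrier_vec n" "y \<in> carrier_vec n"
  shows "x \<bullet>c y = cnj (y \<bullet>c x)"
  using assms by (auto simp: scalar_prod_def mult.commute intro!: sum.cong)

lemma cscalar_prod_eq_0_commute: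
  fixes x y :: "complex vec"
  assumes "x \<in> carrier_vec n" "y \<in> carrier_vec n"
  shows "x \<bullet>c y = 0 \<longleftrightarrow> y \<bullet>c x = 0"
  using cscalar_prod_commute[OF assms] by simp

lemma cscalar_prod_minus_right:
  fixes x y z :: "complex vec"
  assumes "x \<in> carrier_vec n" "y \<in> carrier_vec n" "z \<in> carrier_vec n"
  shows "x \<bullet>c (y - z) = x \<bullet>c y - x \<bullet>c z"
  using assms cscalar_prod_commute[of x n "y - z"] cscalar_prod_commute[of x n y]
    cscalar_prod_commute[of x n z] cscalar_prod_minus_left[of y n z x]
  by simp

lemma cscalar_prod_sum:
  fixes x y :: "complex vec"
  assumes "y \<in> carrier_vec n"
  shows "x \<bullet>c y = (\<Sum>i<n. x $ i * cnj (y $ i))"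
  using assms by (auto simp: scalar_prod_def lessThan_atLeast0)

lemma cscalar_prod_self: "(x :: complex vec) \<bullet>c x = of_real ((vec_l2norm x)\<^sup>2)"
proof -
  have "x \<bullet>c x = (\<Sum>i<dim_vec x. of_real ((cmod (x $ i))\<^sup>2))"
    by (simp add: cscalar_prod_sum[of x "dim_vec x"] complex_norm_square del: of_real_power)
  thus ?thesis by (simp add: vec_l2norm_def sum_nonneg)
qed

lemma vec_l2norm_eq_iff: "vec_l2norm x = vec_l2norm y \<longleftrightarrow> x \<bullet>c x = y \<bullet>c y"
proof -
  have "vec_l2norm z \<ge> 0" for z by (simp add: vec_l2norm_def sum_nonneg)
  thus ?thesis unfolding cscalar_prod_self of_real_eq_iff by (simp add: power2_eq_iff_nonneg)
qed

section \<open>Subspaces, orthonormal lists and completeness\<close>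

definition vsubspace :: "nat \<Rightarrow> complex vec set \<Rightarrow> bool" where
  "vsubspace n S \<longleftrightarrow> S \<subseteq> carrier_vec n \<and> 0\<^sub>v n \<in> S \<and>
     (\<forall>x \<in> S. \<forall>y \<in> S. x + y \<in> S) \<and> (\<forall>a. \<forall>x \<in> S. a \<cdot>\<^sub>v x \<in> S)"

text \<open>For subspaces \<open>S \<subseteq> T\<close> this is the relative orthogonal complement.
  \<open>S\<close> may also be a bare set of vectors, as in \<open>U_vsubspace\<close>, where it is
  a part of a basis.\<close>

definition orth_diff :: "complex vec set \<Rightarrow> complex vec set \<Rightarrow> complex vec set" where
  "orth_diff T S = {x \<in> T. \<forall>y \<in> S. x \<bullet>c y = 0}"

text \<open>Only earlier-against-later pairs are required; conjugate symmetry supplies the others.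
  With \<open>sorted_wrt\<close> the notion splits along \<open>@\<close> and \<open>concat\<close>,
  by which the bases adapted to \<open>A\<close> are assembled.\<close>

definition orthonormal :: "nat \<Rightarrow> complex vec list \<Rightarrow> bool" where
  "orthonormal n bs \<longleftrightarrow> set bs \<subseteq> carrier_vec n \<and> (\<forall>b \<in> set bs. b \<bullet>c b = 1) \<and>
     sorted_wrt (\<lambda>u v. u \<bullet>c v = 0) bs"

text \<open>Completeness is stated as maximality, which is easy to check for lists pieced together
  from several subspaces; that the list spans \<open>S\<close> is recovered in
  \<open>proj_eq_self\<close>.\<close>

definition onb :: "nat \<Rightarrow> complex vec set \<Rightarrow> complex vec list \<Rightarrow> bool" where
  "onb n S bs \<longleftrightarrow> orthonormal n bs \<and> set bs \<subseteq> S \<and>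
     (\<forall>x \<in> S. (\<forall>b \<in> set bs. x \<bullet>c b = 0) \<longrightarrow> x = 0\<^sub>v n)"

lemma vsubspaceD:
  assumes "vsubspace n S"
  shows "S \<subseteq> carrier_vec n" "0\<^sub>v n \<in> S" "x \<in> S \<Longrightarrow> y \<in> S \<Longrightarrow> x + y \<in> S" "x \<in> S \<Longrightarrow> a \<cdot>\<^sub>v x \<in> S"
    "x \<in> S \<Longrightarrow> x \<in> carrier_vec n"
  using assms by (auto simp: vsubspace_def)

lemma vsubspace_minus:
  assumes "vsubspace n S" "x \<in> S" "y \<in> S"
  shows "x - y \<in> S"
proof -
  have "x - y = x + (-1) \<cdot>\<^sub>v y"
    using vsubspaceD(5)[OF assms(1)] assms(2,3) by (intro eq_vecI) auto
  thus ?thesis using vsubspaceD[OF assms(1)] assms(2,3) by metis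
qed

lemma vsubspace_carrier: "vsubspace n (carrier_vec n)"
  by (auto simp: vsubspace_def)

lemma vsubspace_mat_kernel:
  assumes "M \<in> carrier_mat r n"
  shows "vsubspace n (mat_kernel M)"
  using assms
  by (auto simp: vsubspace_def mat_kernel[OF assms] mult_add_distrib_mat_vec[OF assms]
      mult_mat_vec[OF assms])

lemma vsubspace_orth_diff:
  assumes T: "vsubspace n T" and S: "S \<subseteq> carrier_vec n"
  shows "vsubspace n (orth_diff T S)"
proof -
  note T' = vsubspaceD[OF T]
  have "(x + y) \<bullet>c z = 0" if "x \<in> T" "y \<in> T" "z \<in> S" "x \<bullet>c z = 0" "y \<bullet>c z = 0" for x y z
    using that cscalar_prod_add_left[of x n y z] T'(5) S by auto
  moreover have "(a \<cdot>\<^sub>v x) \<bullet>c z = 0" if "x \<in> T" "z \<in> S" "x \<bullet>c z = 0" for x z a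
    using that cscalar_prod_smult_left[of x n z] T'(5) S by auto
  moreover have "0\<^sub>v n \<bullet>c z = 0" if "z \<in> S" for z
    using that S by auto
  ultimately show ?thesis
    using T' unfolding vsubspace_def orth_diff_def by auto
qed

lemma sorted_wrt_concat:
  "sorted_wrt P (concat xss) \<longleftrightarrow>
    (\<forall>xs \<in> set xss. sorted_wrt P xs) \<and>
    sorted_wrt (\<lambda>xs ys. \<forall>x \<in> set xs. \<forall>y \<in> set ys. P x y) xss"
  by (induction xss) (auto simp: sorted_wrt_append)

lemma orthonormal_Nil: "orthonormal n []"
  by (simp add: orthonormal_def)

lemma orthonormal_append:
  "orthonormal n (bs @ cs) \<longleftrightarrow> orthonormal n bs \<and> orthonormal n cs \<and>
     (\<forall>b \<in> set bs. \<forall>c \<in> set cs. b \<bullet>c c = 0)"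
  by (auto simp: orthonormal_def sorted_wrt_append)

lemma orthonormal_concat:
  "orthonormal n (concat bss) \<longleftrightarrow> (\<forall>bs \<in> set bss. orthonormal n bs) \<and>
     sorted_wrt (\<lambda>bs cs. \<forall>b \<in> set bs. \<forall>c \<in> set cs. b \<bullet>c c = 0) bss"
  by (auto simp: orthonormal_def sorted_wrt_concat)

lemma orthonormal_nth:
  assumes "orthonormal n bs" "i < length bs" "j < length bs"
  shows "bs ! i \<bullet>c bs ! j = (if i = j then 1 else 0)"
proof -
  have *: "bs ! p \<bullet>c bs ! q = 0" if "p < q" "q < length bs" for p q
    using assms(1) that by (auto simp: orthonormal_def sorted_wrt_iff_nth_less)
  have "bs ! i \<in> carrier_vec n" "bs ! j \<in> carrier_vec n"
    using assms by (auto simp: orthonormal_def)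
  thus ?thesis
    using *[of i j] *[of j i] assms cscalar_prod_eq_0_commute[of "bs ! i" n "bs ! j"]
    by (cases i j rule: linorder_cases) (auto simp: orthonormal_def)
qed

lemma orthonormalI_nth:
  assumes "set bs \<subseteq> carrier_vec n"
    and "\<And>i j. i < length bs \<Longrightarrow> j < length bs \<Longrightarrow> bs ! i \<bullet>c bs ! j = (if i = j then 1 else 0)"
  shows "orthonormal n bs"
  using assms by (auto simp: orthonormal_def sorted_wrt_iff_nth_less in_set_conv_nth)

lemma orthonormal_unit_vecs: "orthonormal n (unit_vecs n)"
  by (rule orthonormalI_nth) (auto simp: unit_vecs_def)

section \<open>Orthogonal projection, Parseval's identity and Bessel's inequality\<close>

fun proj :: "nat \<Rightarrow> complex vec list \<Rightarrow> complex vec \<Rightarrow> complex vec" where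
  "proj n [] x = 0\<^sub>v n"
| "proj n (b # bs) x = (x \<bullet>c b) \<cdot>\<^sub>v b + proj n bs x"

lemma proj_mem: "vsubspace n S \<Longrightarrow> set bs \<subseteq> S \<Longrightarrow> proj n bs x \<in> S"
  by (induction bs) (auto simp: vsubspaceD)

lemma proj_carrier: "set bs \<subseteq> carrier_vec n \<Longrightarrow> proj n bs x \<in> carrier_vec n"
  using proj_mem[OF vsubspace_carrier] .

lemma proj_cscalar_prod:
  assumes "set bs \<subseteq> carrier_vec n" "y \<in> carrier_vec n"
  shows "proj n bs x \<bullet>c y = (\<Sum>b\<leftarrow>bs. (x \<bullet>c b) * (b \<bullet>c y))"
  using assms
proof (induction bs)
  case (Cons b bs)
  thus ?case
    using cscalar_prod_add_left[of "(x \<bullet>c b) \<cdot>\<^sub>v b" n "proj n bs x" y] proj_carrier[of bs n x]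
    by (simp add: cscalar_prod_smult_left)
qed simp

text \<open>Pushing \<open>M\<close> through the finite sum takes the place of an adjoint: once
  \<open>proj n bs x = x\<close>, it describes \<open>M x\<close> by the images of the basis
  vectors.\<close>

lemma mult_mat_proj_cscalar_prod:
  assumes "set bs \<subseteq> carrier_vec n" "y \<in> carrier_vec r" "M \<in> carrier_mat r n"
  shows "(M *\<^sub>v proj n bs x) \<bullet>c y = (\<Sum>b\<leftarrow>bs. (x \<bullet>c b) * ((M *\<^sub>v b) \<bullet>c y))"
  using assms
proof (induction bs)
  case (Cons b bs)
  have "M *\<^sub>v proj n (b # bs) x = (x \<bullet>c b) \<cdot>\<^sub>v (M *\<^sub>v b) + M *\<^sub>v proj n bs x"
    using Cons.prems proj_carrier[of bs n x]
    by (simp add: mult_add_distrib_mat_vec[OF assms(3)] mult_mat_vec[OF assms(3)])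
  thus ?case
    using Cons proj_carrier[of bs n x]
      cscalar_prod_add_left[of "(x \<bullet>c b) \<cdot>\<^sub>v (M *\<^sub>v b)" r "M *\<^sub>v proj n bs x" y]
    by (simp add: cscalar_prod_smult_left[where n = r])
next
  case Nil
  have "M *\<^sub>v 0\<^sub>v n = 0\<^sub>v r" using assms(3) by (intro eq_vecI) auto
  thus ?case using assms(2) by simp
qed

lemma sum_list_eq_zero:
  fixes f :: "'a \<Rightarrow> 'b::comm_monoid_add"
  shows "(\<And>x. x \<in> set xs \<Longrightarrow> f x = 0) \<Longrightarrow> (\<Sum>x\<leftarrow>xs. f x) = 0"
  by (induction xs) auto

lemma sum_list_eq_single:
  fixes f :: "'a \<Rightarrow> 'b::comm_monoid_add"
  assumes "i < length xs" "\<And>j. j < length xs \<Longrightarrow> j \<noteq> i \<Longrightarrow> f (xs ! j) = 0"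
  shows "(\<Sum>x\<leftarrow>xs. f x) = f (xs ! i)"
proof -
  have "(\<Sum>x\<leftarrow>xs. f x) = (\<Sum>j\<in>{0..<length xs}. f (xs ! j))"
    by (simp add: sum_list_sum_nth)
  also have "\<dots> = (\<Sum>j\<in>{i}. f (xs ! j))"
    using assms by (intro sum.mono_neutral_right) auto
  finally show ?thesis by simp
qed

lemma proj_cscalar_prod_mem:
  assumes "orthonormal n bs" "b \<in> set bs"
  shows "proj n bs x \<bullet>c b = x \<bullet>c b"
proof -
  obtain i where i: "i < length bs" "b = bs ! i" using assms(2) by (auto simp: in_set_conv_nth)
  have "proj n bs x \<bullet>c b = (\<Sum>c\<leftarrow>bs. (x \<bullet>c c) * (c \<bullet>c b))"
    using assms by (intro proj_cscalar_prod) (auto simp: orthonormal_def)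
  also have "\<dots> = (x \<bullet>c (bs ! i)) * ((bs ! i) \<bullet>c b)"
    using i assms(1) by (intro sum_list_eq_single) (auto simp: orthonormal_nth)
  finally show ?thesis using i assms(1) by (simp add: orthonormal_nth)
qed

lemma diff_proj_orthogonal:
  assumes "orthonormal n bs" "b \<in> set bs" "x \<in> carrier_vec n"
  shows "(x - proj n bs x) \<bullet>c b = 0"
  using assms cscalar_prod_minus_left[of x n "proj n bs x" b] proj_carrier[of bs n x]
    proj_cscalar_prod_mem[OF assms(1,2), of x]
  by (auto simp: orthonormal_def)

lemma vec_minus_eq_0D:
  fixes x y :: "complex vec"
  assumes "x \<in> carrier_vec n" "y \<in> carrier_vec n" "x - y = 0\<^sub>v n"
  shows "x = y"
proof (rule eq_vecI)
  show "x $ i = y $ i" if "i < dim_vec y" for i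
    using arg_cong[OF assms(3), of "\<lambda>v. v $ i"] that assms(1,2) by simp
qed (use assms in auto)

text \<open>The residual \<open>x - proj n bs x\<close> stays in \<open>S\<close> and is orthogonal
  to \<open>bs\<close>, so completeness forces it to vanish.\<close>

lemma proj_eq_self:
  assumes "onb n S bs" "vsubspace n S" "x \<in> S"
  shows "proj n bs x = x"
proof -
  have bs: "orthonormal n bs" "set bs \<subseteq> S" using assms(1) by (auto simp: onb_def)
  have p: "proj n bs x \<in> S" using assms(2) bs by (intro proj_mem)
  hence "x - proj n bs x = 0\<^sub>v n"
    using assms diff_proj_orthogonal[OF bs(1)] vsubspaceD(5)[OF assms(2)]
      vsubspace_minus[OF assms(2,3) p]
    by (auto simp: onb_def)
  thus ?thesis
    using p assms(3) vsubspaceD(5)[OF assms(2)] vec_minus_eq_0D[of x n "proj n bs x"] by auto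
qed

lemma parseval:
  assumes "onb n S bs" "vsubspace n S" "x \<in> S" "y \<in> carrier_vec n"
  shows "x \<bullet>c y = (\<Sum>b\<leftarrow>bs. (x \<bullet>c b) * (b \<bullet>c y))"
proof -
  have "set bs \<subseteq> carrier_vec n" using assms(1) by (auto simp: onb_def orthonormal_def)
  thus ?thesis
    using proj_cscalar_prod[of bs n y x] proj_eq_self[OF assms(1-3)] assms(4) by simp
qed

lemma onb_orthogonal:
  assumes "onb n S bs" "vsubspace n S" "y \<in> carrier_vec n" "\<And>b. b \<in> set bs \<Longrightarrow> y \<bullet>c b = 0" "x \<in> S"
  shows "y \<bullet>c x = 0"
proof -
  have "b \<bullet>c y = 0" if "b \<in> set bs" for b
    using that assms(1,3,4) cscalar_prod_eq_0_commute[of b n y] by (auto simp: onb_def orthonormal_def)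
  hence "x \<bullet>c y = 0"
    unfolding parseval[OF assms(1,2,5,3)] by (intro sum_list_eq_zero) auto
  thus ?thesis
    using cscalar_prod_eq_0_commute[of x n y] assms vsubspaceD(5)[OF assms(2)] by auto
qed

lemma sum_list_swap:
  fixes f :: "'a \<Rightarrow> 'b \<Rightarrow> 'c::comm_monoid_add"
  shows "(\<Sum>x\<leftarrow>xs. \<Sum>y\<leftarrow>ys. f x y) = (\<Sum>y\<leftarrow>ys. \<Sum>x\<leftarrow>xs. f x y)"
  by (induction xs) (auto simp: sum_list_addf)

text \<open>With \<open>p\<close> the projection of \<open>b\<close>, the right side minus the left
  side is the squared norm of \<open>b - p\<close>. The order is that of the complex numbers, in
  which comparable numbers share their imaginary part.\<close>

lemma bessel:
  assumes "orthonormal n cs" "b \<in> carrier_vec n"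
  shows "(\<Sum>c\<leftarrow>cs. (b \<bullet>c c) * (c \<bullet>c b)) \<le> b \<bullet>c b"
proof -
  let ?p = "proj n cs b"
  have cs: "set cs \<subseteq> carrier_vec n" using assms(1) by (auto simp: orthonormal_def)
  note p = proj_carrier[OF cs, of b]
  have "(b - ?p) \<bullet>c ?p = 0"
  proof -
    have "?p \<bullet>c (b - ?p) = (\<Sum>c\<leftarrow>cs. (b \<bullet>c c) * (c \<bullet>c (b - ?p)))"
      using p assms(2) by (intro proj_cscalar_prod cs) auto
    also have "\<dots> = (\<Sum>c\<leftarrow>cs. 0)"
      using diff_proj_orthogonal[OF assms(1) _ assms(2)] cs p assms(2)
        cscalar_prod_eq_0_commute[of _ n "b - ?p"]
      by (intro arg_cong[where f = sum_list] map_cong refl) auto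
    finally show ?thesis
      using cscalar_prod_eq_0_commute[of ?p n "b - ?p"] p assms(2) by simp
  qed
  moreover have "0 \<le> (b - ?p) \<bullet>c (b - ?p)" by auto
  ultimately have "0 \<le> b \<bullet>c b - ?p \<bullet>c b"
    using cscalar_prod_minus_right[of "b - ?p" n b ?p] cscalar_prod_minus_left[of b n ?p b]
      p assms(2) by simp
  thus ?thesis using proj_cscalar_prod[OF cs assms(2), of b] by simp
qed

lemma orthonormal_sum_self:
  "orthonormal n bs \<Longrightarrow> (\<Sum>b\<leftarrow>bs. b \<bullet>c b) = of_nat (length bs)"
  by (induction bs) (auto simp: orthonormal_def)

text \<open>Double counting of the squared inner products between \<open>cs\<close> and
  \<open>bs\<close>: by Parseval each \<open>c\<close> contributes 1, by Bessel each
  \<open>b\<close> contributes at most 1. This yields invariance of dimension without linear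
  independence.\<close>

lemma orthonormal_length_le:
  assumes "onb n S bs" "vsubspace n S" "orthonormal n cs" "set cs \<subseteq> S"
  shows "length cs \<le> length bs"
proof -
  have bs: "orthonormal n bs" "set bs \<subseteq> carrier_vec n"
    using assms(1) by (auto simp: onb_def orthonormal_def)
  have "complex_of_nat (length cs) = (\<Sum>c\<leftarrow>cs. c \<bullet>c c)"
    using orthonormal_sum_self[OF assms(3)] by simp
  also have "\<dots> = (\<Sum>c\<leftarrow>cs. \<Sum>b\<leftarrow>bs. (c \<bullet>c b) * (b \<bullet>c c))"
    using assms parseval[OF assms(1,2)] vsubspaceD(5)[OF assms(2)]
    by (intro arg_cong[where f = sum_list] map_cong refl) auto
  also have "\<dots> = (\<Sum>b\<leftarrow>bs. \<Sum>c\<leftarrow>cs. (b \<bullet>c c) * (c \<bullet>c b))"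
    by (subst sum_list_swap) (simp add: mult.commute)
  also have "\<dots> \<le> (\<Sum>b\<leftarrow>bs. b \<bullet>c b)"
    using bessel[OF assms(3)] bs(2) by (intro sum_list_mono) auto
  also have "\<dots> = complex_of_nat (length bs)" by (rule orthonormal_sum_self[OF bs(1)])
  finally have "complex_of_nat (length cs) \<le> complex_of_nat (length bs)" .
  thus ?thesis by (simp add: less_eq_complex_def)
qed

lemma onb_length_unique:
  assumes "onb n S bs" "onb n S cs" "vsubspace n S"
  shows "length bs = length cs"
  using assms orthonormal_length_le[OF assms(1,3), of cs] orthonormal_length_le[OF assms(2,3), of bs]
  by (auto simp: onb_def)

section \<open>Existence and extension of orthonormal bases\<close>

lemma onb_unit_vecs: "onb n (carrier_vec n) (unit_vecs n)"
proof -
  have "x = 0\<^sub>v n" if "x \<in> carrier_vec n" "\<forall>b \<in> set (unit_vecs n). x \<bullet>c b = 0" for x :: "complex vec"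
  proof (intro eq_vecI)
    fix i assume i: "i < dim_vec (0\<^sub>v n :: complex vec)"
    hence "x \<bullet>c unit_vec n i = 0" using that by (auto simp: unit_vecs_def)
    moreover have "x \<bullet>c unit_vec n i = (\<Sum>j\<in>{i}. x $ j * cnj (unit_vec n i $ j))"
      unfolding cscalar_prod_sum[of "unit_vec n i" n x, simplified]
      using i by (intro sum.mono_neutral_right) (auto simp: unit_vec_def)
    ultimately show "x $ i = 0\<^sub>v n $ i" using i by simp
  qed (use that in auto)
  thus ?thesis using orthonormal_unit_vecs[of n] by (auto simp: onb_def orthonormal_def)
qed

lemma onb_carrier_length:
  assumes "onb n (carrier_vec n) bs"
  shows "length bs = n"
  using onb_length_unique[OF assms onb_unit_vecs vsubspace_carrier] by (simp add: unit_vecs_def)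

text \<open>Lengths are bounded by \<open>n\<close>, so there is an extension of maximal length; a
  nonzero vector of \<open>S\<close> orthogonal to it could be normalized and appended. Maximality
  takes the place of Gram-Schmidt.\<close>

lemma onb_extend:
  assumes S: "vsubspace n S" and "orthonormal n cs" "set cs \<subseteq> S"
  obtains ds where "onb n S (cs @ ds)"
proof -
  let ?P = "\<lambda>ds. orthonormal n (cs @ ds) \<and> set (cs @ ds) \<subseteq> S"
  have "length ds \<le> n" if "?P ds" for ds
    using orthonormal_length_le[OF onb_unit_vecs vsubspace_carrier, of n "cs @ ds"] that
    by (auto simp: orthonormal_def unit_vecs_def)
  moreover have "?P []" using assms by simp
  ultimately have "\<exists>ds. ?P ds \<and> (\<forall>es. ?P es \<longrightarrow> length es \<le> length ds)"
    by (intro ex_has_greatest_nat[of ?P "[]" length "Suc n"]) (auto simp: less_Suc_eq_le)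
  then obtain ds where ds: "?P ds" and max: "\<And>es. ?P es \<Longrightarrow> length es \<le> length ds"
    by blast
  have "x = 0\<^sub>v n" if x: "x \<in> S" "\<forall>b \<in> set (cs @ ds). x \<bullet>c b = 0" for x
  proof (rule ccontr)
    assume "x \<noteq> 0\<^sub>v n"
    let ?r = "vec_l2norm x"
    let ?y = "complex_of_real (1 / ?r) \<cdot>\<^sub>v x"
    have xc: "x \<in> carrier_vec n" using x vsubspaceD(5)[OF S] by auto
    have "x \<bullet>c x \<noteq> 0" using \<open>x \<noteq> 0\<^sub>v n\<close> xc by simp
    hence "?r \<noteq> 0" by (auto simp: cscalar_prod_self)
    have "?y \<bullet>c ?y = complex_of_real (1 / ?r) * (complex_of_real (1 / ?r) * (x \<bullet>c x))"
      using xc cscalar_prod_smult_left[of x n ?y] cscalar_prod_smult_right[of x n x]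
      by (simp del: of_real_divide)
    hence y1: "?y \<bullet>c ?y = 1"
      using \<open>?r \<noteq> 0\<close> by (simp add: cscalar_prod_self power2_eq_square)
    have cds: "set (cs @ ds) \<subseteq> carrier_vec n" using ds by (auto simp: orthonormal_def)
    have "b \<bullet>c ?y = 0" if b: "b \<in> set (cs @ ds)" for b
      using b cds xc x(2) cscalar_prod_smult_right[of b n x] cscalar_prod_eq_0_commute[of b n x]
      by (auto simp del: of_real_divide)
    hence "orthonormal n ((cs @ ds) @ [?y])"
      using ds y1 xc orthonormal_append[of n "cs @ ds" "[?y]"] by (simp add: orthonormal_def)
    hence "?P (ds @ [?y])" using ds x(1) vsubspaceD(4)[OF S] by auto
    from max[OF this] show False by simp
  qed
  thus ?thesis using that[of ds] ds by (auto simp: onb_def)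
qed

lemma onb_exists:
  assumes "vsubspace n S"
  obtains bs where "onb n S bs"
  using onb_extend[OF assms orthonormal_Nil] by auto

text \<open>A vector orthogonal to a basis of \<open>S\<close> is orthogonal to all of
  \<open>S\<close>, so inside \<open>T\<close> it falls into the complement, where \<open>cs\<close>
  is complete.\<close>

lemma onb_orth_diff_append:
  assumes "vsubspace n S" "S \<subseteq> T" "T \<subseteq> carrier_vec n" "onb n S bs" "onb n (orth_diff T S) cs"
  shows "onb n T (bs @ cs)"
proof -
  have bs: "orthonormal n bs" "set bs \<subseteq> S" and cs: "orthonormal n cs" "set cs \<subseteq> orth_diff T S"
    using assms(4,5) by (auto simp: onb_def)
  have "b \<bullet>c c = 0" if "b \<in> set bs" "c \<in> set cs" for b c
  proof -
    have "c \<bullet>c b = 0" using that bs(2) cs(2) by (auto simp: orth_diff_def)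
    thus ?thesis
      using that bs(1) cs(1) cscalar_prod_eq_0_commute[of b n c] by (auto simp: orthonormal_def)
  qed
  moreover have "x = 0\<^sub>v n" if x: "x \<in> T" "\<forall>b \<in> set (bs @ cs). x \<bullet>c b = 0" for x
  proof -
    have "x \<bullet>c y = 0" if "y \<in> S" for y
      by (rule onb_orthogonal[OF assms(4,1) _ _ that]) (use x assms(3) in auto)
    hence "x \<in> orth_diff T S" using x by (auto simp: orth_diff_def)
    thus ?thesis using assms(5) x by (auto simp: onb_def)
  qed
  ultimately show ?thesis
    unfolding onb_def orthonormal_append using bs cs assms(2) by (auto simp: orth_diff_def)
qed

text \<open>An extension to a basis has length \<open>n\<close>, so nothing was added. Spanning is
  thereby reduced to counting, which is how the Jordan chains are handled.\<close>

lemma onb_carrierI: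
  assumes "orthonormal n bs" "length bs = n"
  shows "onb n (carrier_vec n) bs"
proof -
  have "set bs \<subseteq> carrier_vec n" using assms(1) by (simp add: orthonormal_def)
  then obtain ds where "onb n (carrier_vec n) (bs @ ds)"
    using onb_extend[OF vsubspace_carrier assms(1)] by metis
  thus ?thesis using onb_carrier_length[of n "bs @ ds"] assms(2) by auto
qed

section \<open>Kernel dimension and rank\<close>

lemma orthonormal_distinct:
  assumes "orthonormal n bs"
  shows "distinct bs"
  unfolding distinct_conv_nth
proof (intro allI impI)
  fix i j assume "i < length bs" "j < length bs" "i \<noteq> j"
  thus "bs ! i \<noteq> bs ! j" using orthonormal_nth[OF assms, of i j] orthonormal_nth[OF assms, of j j] by auto
qed

lemma proj_index:
  assumes "set bs \<subseteq> carrier_vec n" "i < n"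
  shows "proj n bs x $ i = (\<Sum>b\<leftarrow>bs. (x \<bullet>c b) * b $ i)"
  using assms
proof (induction bs)
  case (Cons b bs)
  thus ?case using proj_carrier[of bs n x] by (auto simp: carrier_vecD)
qed simp

text \<open>The bridge from bases in the sense of linear independence to orthonormal lists.
  Independence follows from the inner product of a vanishing combination with one of the vectors,
  spanning from \<open>proj_eq_self\<close>.\<close>

lemma kernel_dim_eq_length_onb:
  assumes M: "M \<in> carrier_mat r n" and bs: "onb n (mat_kernel M) bs"
  shows "kernel_dim M = length bs"
proof -
  interpret K: kernel r n M by unfold_locales (rule M)
  have dim: "kernel_dim M = K.dim" by simp
  have o: "orthonormal n bs" and sub: "set bs \<subseteq> mat_kernel M"
    and c: "set bs \<subseteq> carrier_vec n"
    using bs by (auto simp: onb_def orthonormal_def)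
  have comb: "K.NC.lincomb a (set bs) $ i = (\<Sum>b\<in>set bs. a b * b $ i)" if "i < n" for a i
    using K.NC.lincomb_index[OF that c] .
  have "a v = 0" if "K.NC.lincomb a (set bs) = 0\<^sub>v n" "v \<in> set bs" for a v
  proof -
    note v_mem = that(2)
    have v: "v \<in> carrier_vec n" using that c by auto
    have "K.NC.lincomb a (set bs) \<bullet>c v = (\<Sum>i<n. \<Sum>b\<in>set bs. a b * b $ i * cnj (v $ i))"
      using v comb by (simp add: cscalar_prod_sum[OF v] sum_distrib_right)
    also have "\<dots> = (\<Sum>b\<in>set bs. a b * (b \<bullet>c v))"
      by (subst sum.swap) (simp add: cscalar_prod_sum[OF v] sum_distrib_left mult.assoc)
    also have "\<dots> = (\<Sum>b\<in>{v}. a b * (b \<bullet>c v))"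
    proof (rule sum.mono_neutral_right)
      show "\<forall>b \<in> set bs - {v}. a b * (b \<bullet>c v) = 0"
      proof
        fix b assume "b \<in> set bs - {v}"
        then obtain i j where "i < length bs" "j < length bs" "b = bs ! i" "v = bs ! j" "i \<noteq> j"
          using v_mem by (metis DiffE in_set_conv_nth singletonI)
        thus "a b * (b \<bullet>c v) = 0" using orthonormal_nth[OF o] by simp
      qed
    qed (use that in auto)
    also have "\<dots> = a v" using o that by (simp add: orthonormal_def)
    finally show ?thesis using that v by simp
  qed
  hence "K.NC.lin_indpt (set bs)" 
    using c by (intro K.NC.finite_lin_indpt2) auto
  hence ind: "K.lin_indpt (set bs)" using K.lindep_same[OF sub] by simp
  have "x \<in> K.NC.span (set bs)" if "x \<in> mat_kernel M" for x
  proof -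
    have "x = proj n bs x" using proj_eq_self[OF bs vsubspace_mat_kernel[OF M] that] by simp
    also have "\<dots> = K.NC.lincomb (\<lambda>b. x \<bullet>c b) (set bs)"
    proof (rule eq_vecI)
      show dim: "dim_vec (proj n bs x) = dim_vec (K.NC.lincomb (\<lambda>b. x \<bullet>c b) (set bs))"
        using K.NC.lincomb_dim[OF _ c] proj_carrier[OF c] by simp
      fix i assume "i < dim_vec (K.NC.lincomb (\<lambda>b. x \<bullet>c b) (set bs))"
      hence "i < n" using dim proj_carrier[OF c, of x] by simp
      thus "proj n bs x $ i = K.NC.lincomb (\<lambda>b. x \<bullet>c b) (set bs) $ i"
        using proj_index[OF c] comb
        by (simp add: sum_list_distinct_conv_sum_set[OF orthonormal_distinct[OF o]])
    qed
    finally show ?thesis unfolding K.NC.span_def by blast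
  qed
  moreover have "K.span (set bs) \<subseteq> mat_kernel M" using K.Ker.span_is_subset2[OF sub] by simp
  ultimately have gen: "K.span (set bs) = mat_kernel M" using K.span_same[OF sub] by blast
  have "K.basis (set bs)" unfolding K.Ker.basis_def using ind gen sub by simp
  thus ?thesis
    using K.Ker.dim_basis[of "set bs"] dim distinct_card[OF orthonormal_distinct[OF o]] by simp
qed

text \<open>The rank is the dimension of the column space, which is the image of
  \<open>v \<mapsto> M v\<close>, so the theorem for linear maps applies.\<close>

lemma rank_nullity_mat:
  fixes M :: "complex mat"
  assumes M: "M \<in> carrier_mat r n"
  shows "vec_space.rank r M + kernel_dim M = n"
proof -
  interpret K: kernel r n M by unfold_locales (rule M)
  interpret W: vec_space "TYPE(complex)" r .
  have hom: "(\<lambda>v. M *\<^sub>v v) \<in> LinearCombinations.module_hom class_ring K.NC.V W.V"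
    using M by (auto simp: LinearCombinations.module_hom_def module_vec_simps class_ring_simps
        mult_add_distrib_mat_vec[OF M] mult_mat_vec[OF M])
  interpret L: linear_map class_ring K.NC.V W.V "\<lambda>v. M *\<^sub>v v"
    by unfold_locales (rule hom)
  have "L.imT = W.span (set (cols M))"
    using W.col_space_eq[OF M] M unfolding L.im_def W.col_space_def by (auto simp: module_vec_simps)
  hence 1: "vectorspace.dim class_ring (W.vs L.imT) = W.rank M"
    unfolding W.rank_def by simp
  have "L.kerT = mat_kernel M"
    unfolding L.ker_def mat_kernel[OF M] by (simp add: module_vec_simps)
  hence 2: "vectorspace.dim class_ring (K.NC.vs L.kerT) = kernel_dim M" by simp
  show ?thesis using L.rank_nullity[OF K.NC.fin_dim] 1 2 K.NC.dim_is_n by simp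
qed

section \<open>Matrices with respect to orthonormal lists\<close>

text \<open>For an orthonormal basis \<open>bs = cs\<close> this is the matrix of \<open>A\<close>
  in that basis; for two different lists it is a rectangular block of such a matrix.\<close>

definition coord_mat :: "complex mat \<Rightarrow> complex vec list \<Rightarrow> complex vec list \<Rightarrow> complex mat" where
  "coord_mat A bs cs = mat (length bs) (length cs) (\<lambda>(i, j). (A *\<^sub>v cs ! j) \<bullet>c bs ! i)"

lemma coord_mat_simps [simp]:
  "coord_mat A bs cs \<in> carrier_mat (length bs) (length cs)"
  "dim_row (coord_mat A bs cs) = length bs" "dim_col (coord_mat A bs cs) = length cs"
  "i < length bs \<Longrightarrow> j < length cs \<Longrightarrow> coord_mat A bs cs $$ (i, j) = (A *\<^sub>v cs ! j) \<bullet>c bs ! i"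
  by (auto simp: coord_mat_def)

lemma coord_mat_append:
  "coord_mat A (bs @ bs') (cs @ cs') =
     four_block_mat (coord_mat A bs cs) (coord_mat A bs cs') (coord_mat A bs' cs) (coord_mat A bs' cs')"
  by (rule eq_matI) (auto simp: nth_append)

lemma coord_mat_eq_0:
  assumes "\<And>b c. b \<in> set bs \<Longrightarrow> c \<in> set cs \<Longrightarrow> (A *\<^sub>v c) \<bullet>c b = 0"
  shows "coord_mat A bs cs = 0\<^sub>m (length bs) (length cs)"
  using assms by (intro eq_matI) auto

lemma mat_adjoint_carrier: "A \<in> carrier_mat r c \<Longrightarrow> mat_adjoint A \<in> carrier_mat c r"
  by (auto simp: mat_adjoint_def)

lemma mat_adjoint_mult_index:
  assumes "U \<in> carrier_mat n r" "V \<in> carrier_mat n c" "i < r" "j < c"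
  shows "(mat_adjoint U * V) $$ (i, j) = col V j \<bullet>c col U i"
proof -
  have "(mat_adjoint U * V) $$ (i, j) = conjugate (col U i) \<bullet> col V j"
    using assms by (auto simp: mat_adjoint_def)
  also have "\<dots> = col V j \<bullet>c col U i"
    using assms by (intro conjugate_vec_sprod_comm[symmetric, where n = n]) auto
  finally show ?thesis .
qed

text \<open>The basis vectors are the columns of the unitary matrix \<open>U\<close>, and the
  entries of \<open>mat_adjoint U * (A * U)\<close> are the inner products of \<open>A u_j\<close>
  with \<open>u_i\<close>.\<close>

lemma unitary_similar_coord_mat:
  assumes A: "A \<in> carrier_mat n n" and bs: "onb n (carrier_vec n) bs"
  shows "unitary_similar A (coord_mat A bs bs)"
proof -
  note len = onb_carrier_length[OF bs]
  have o: "orthonormal n bs" and c: "set bs \<subseteq> carrier_vec n"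
    using bs by (auto simp: onb_def orthonormal_def)
  define U where "U = mat_of_cols n bs"
  have U: "U \<in> carrier_mat n n" using len by (auto simp: U_def)
  note U' = mat_adjoint_carrier[OF U]
  have col: "col U i = bs ! i" if "i < n" for i
    using that len c unfolding U_def by (intro col_mat_of_cols) auto
  have 1: "mat_adjoint U * U = 1\<^sub>m n"
    using U U'
    by (intro eq_matI)
      (auto simp: mat_adjoint_mult_index[OF U U] col orthonormal_nth[OF o] len
         simp del: col_mult index_mult_mat(1))
  have 2: "U * mat_adjoint U = 1\<^sub>m n"
    by (rule mat_mult_left_right_inverse[OF U' U 1])
  have AU: "A * U \<in> carrier_mat n n" using A U by simp
  have "coord_mat A bs bs = mat_adjoint U * (A * U)"
    using A U U' AU
    by (intro eq_matI)
      (auto simp: mat_adjoint_mult_index[OF U AU] col col_mult2[OF A U] len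
         simp del: col_mult index_mult_mat(1))
  hence "U * coord_mat A bs bs * mat_adjoint U = U * (mat_adjoint U * (A * U)) * mat_adjoint U"
    by simp
  also have "\<dots> = (U * mat_adjoint U) * (A * (U * mat_adjoint U))"
    using A U U' by (simp add: assoc_mult_mat[of _ n n _ n _ n])
  finally have "A = U * coord_mat A bs bs * mat_adjoint U" using A 2 by simp
  hence "similar_mat_wit A (coord_mat A bs bs) U (mat_adjoint U)"
    using A U U' 1 2 len coord_mat_simps(1)[of A bs bs] by (auto simp: similar_mat_wit_def Let_def)
  thus ?thesis by (auto simp: unitary_similar_def)
qed

lemma unitary_similarE:
  assumes A: "A \<in> carrier_mat n n" and "unitary_similar A M"
  obtains bs where "onb n (carrier_vec n) bs" "M = coord_mat A bs bs"
proof -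
  obtain U where "similar_mat_wit A M U (mat_adjoint U)"
    using assms(2) by (auto simp: unitary_similar_def)
  hence U: "U \<in> carrier_mat n n" and U': "mat_adjoint U \<in> carrier_mat n n"
    and M: "M \<in> carrier_mat n n" and 1: "mat_adjoint U * U = 1\<^sub>m n"
    and eq: "A = U * M * mat_adjoint U"
    using A by (auto simp: similar_mat_wit_def Let_def)
  have "orthonormal n (cols U)"
  proof (rule orthonormalI_nth)
    show "set (cols U) \<subseteq> carrier_vec n" using U by (auto simp: cols_def)
    fix i j assume "i < length (cols U)" "j < length (cols U)"
    hence ij: "i < n" "j < n" using U by auto
    hence "cols U ! i \<bullet>c cols U ! j = (mat_adjoint U * U) $$ (j, i)"
      using U by (simp add: mat_adjoint_mult_index[OF U U])
    thus "cols U ! i \<bullet>c cols U ! j = (if i = j then 1 else 0)" using ij unfolding 1 by auto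
  qed
  hence "onb n (carrier_vec n) (cols U)" using U by (intro onb_carrierI) auto
  moreover have "M = coord_mat A (cols U) (cols U)"
  proof -
    have AU: "A * U \<in> carrier_mat n n" using A U by simp
    have "mat_adjoint U * (A * U) = (mat_adjoint U * U) * (M * (mat_adjoint U * U))"
      unfolding eq using M U U' by (simp add: assoc_mult_mat[of _ n n _ n _ n])
    hence "M = mat_adjoint U * (A * U)" using 1 M by simp
    also have "\<dots> = coord_mat A (cols U) (cols U)"
      using A U U' AU
      by (intro eq_matI)
        (auto simp: mat_adjoint_mult_index[OF U AU] col_mult2[OF A U] simp del: col_mult index_mult_mat(1))
    finally show ?thesis .
  qed
  ultimately show ?thesis using that by blast
qed

text \<open>\<open>EW\<close> omits \<open>i = k\<close>, where \<open>B\<close> sits, and nothing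
  is asked of \<open>W\<close> against itself, where \<open>C\<close> sits. The induction descends
  from \<open>k\<close> because \<open>superdiag_mat\<close> grows from the lower right
  corner.\<close>

lemma superdiag_mat_coord_mat:
  assumes "1 \<le> j" "j \<le> k"
    and EE: "\<And>i t e f. \<lbrakk>i \<in> {1..k}; t \<in> {1..k}; t \<noteq> Suc i; e \<in> set (E i); f \<in> set (E t)\<rbrakk>
               \<Longrightarrow> (A *\<^sub>v f) \<bullet>c e = 0"
    and EW: "\<And>i e w. \<lbrakk>i \<in> {1..<k}; e \<in> set (E i); w \<in> set W\<rbrakk> \<Longrightarrow> (A *\<^sub>v w) \<bullet>c e = 0"
    and WE: "\<And>i e w. \<lbrakk>i \<in> {1..k}; e \<in> set (E i); w \<in> set W\<rbrakk> \<Longrightarrow> (A *\<^sub>v e) \<bullet>c w = 0"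
  shows "superdiag_mat (map (\<lambda>i. coord_mat A (E i) (E (Suc i))) [j..<k] @ [coord_mat A (E k) W]) (coord_mat A W W)
    = coord_mat A (concat (map E [j..<Suc k]) @ W) (concat (map E [j..<Suc k]) @ W)"
  using assms(2,1)
proof (induction rule: inc_induct)
  case base
  have "coord_mat A (E k) (E k) = 0\<^sub>m (length (E k)) (length (E k))"
    using EE[of k k] base by (intro coord_mat_eq_0) auto
  moreover have "coord_mat A W (E k) = 0\<^sub>m (length W) (length (E k))"
    using WE[of k] base by (intro coord_mat_eq_0) auto
  ultimately show ?case
    by (simp add: coord_mat_append superdiag_mat_single[of _ "length (E k)" "length W"]
        del: superdiag_mat.simps)
next
  case (step j)
  let ?r = "concat (map E [Suc j..<Suc k]) @ W"
  let ?r' = "concat (map E [Suc (Suc j)..<Suc k]) @ W"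
  have r: "?r = E (Suc j) @ ?r'"
    using step.hyps by (simp add: upt_conv_Cons[of "Suc j" "Suc k"] del: upt_Suc)
  have mem: "b \<in> set W \<or> (\<exists>i \<in> {a..k}. b \<in> set (E i))"
    if "b \<in> set (concat (map E [a..<Suc k]) @ W)" for a b
    using that by (auto simp: less_Suc_eq_le simp del: upt_Suc)
  have 1: "coord_mat A (E j) (E j) = 0\<^sub>m (length (E j)) (length (E j))"
    using EE[of j j] step by (intro coord_mat_eq_0) auto
  have 2: "coord_mat A ?r (E j) = 0\<^sub>m (length ?r) (length (E j))"
  proof (intro coord_mat_eq_0)
    fix b c assume b: "b \<in> set ?r" and c: "c \<in> set (E j)"
    from mem[OF b] consider "b \<in> set W" | i where "i \<in> {Suc j..k}" "b \<in> set (E i)" by blast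
    thus "(A *\<^sub>v c) \<bullet>c b = 0"
    proof cases
      case 1
      show ?thesis by (rule WE[OF _ c 1]) (use step.prems step.hyps in simp)
    next
      case (2 i)
      show ?thesis by (rule EE[OF _ _ _ 2(2) c]) (use 2(1) step.prems step.hyps in simp_all)
    qed
  qed
  \<comment> \<open>Columns beyond the layer \<open>Suc j\<close> meet the row block
    \<open>E j\<close> in zeros; they are the columns that \<open>pad_cols\<close> fills in.\<close>
  have z: "(A *\<^sub>v c) \<bullet>c e = 0" if "c \<in> set ?r'" "e \<in> set (E j)" for c e
  proof -
    from mem[OF that(1)] consider "c \<in> set W" | i where "i \<in> {Suc (Suc j)..k}" "c \<in> set (E i)" by blast
    thus ?thesis
    proof cases
      case 1
      show ?thesis by (rule EW[OF _ that(2) 1]) (use step.prems step.hyps in simp)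
    next
      case (2 i)
      show ?thesis by (rule EE[OF _ _ _ that(2) 2(2)]) (use 2(1) step.prems step.hyps in simp_all)
    qed
  qed
  have 3: "coord_mat A (E j) ?r = pad_cols (length ?r) (coord_mat A (E j) (E (Suc j)))"
  proof (rule eq_matI)
    fix p q
    assume "p < dim_row (pad_cols (length ?r) (coord_mat A (E j) (E (Suc j))))"
      "q < dim_col (pad_cols (length ?r) (coord_mat A (E j) (E (Suc j))))"
    hence pq: "p < length (E j)" "q < length ?r" by (simp_all add: pad_cols_def)
    show "coord_mat A (E j) ?r $$ (p, q) = pad_cols (length ?r) (coord_mat A (E j) (E (Suc j))) $$ (p, q)"
    proof (cases "q < length (E (Suc j))")
      case True
      thus ?thesis using pq unfolding r by (simp add: pad_cols_def nth_append)
    next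
      case False
      hence "?r ! q = ?r' ! (q - length (E (Suc j)))" "q - length (E (Suc j)) < length ?r'"
        using pq unfolding r by (auto simp: nth_append)
      hence "?r ! q \<in> set ?r'" by (metis nth_mem)
      hence "(A *\<^sub>v ?r ! q) \<bullet>c E j ! p = 0" using pq(1) by (intro z nth_mem)
      thus ?thesis using pq False by (simp add: pad_cols_def del: upt_Suc map_append concat_append)
    qed
  qed (simp_all add: pad_cols_def)
  let ?X = "\<lambda>i. coord_mat A (E i) (E (Suc i))"
  have "superdiag_mat (map ?X [Suc j..<k] @ [coord_mat A (E k) W]) (coord_mat A W W) = coord_mat A ?r ?r"
    using step by simp
  hence "superdiag_mat (map ?X [j..<k] @ [coord_mat A (E k) W]) (coord_mat A W W) =
    four_block_mat (0\<^sub>m (length (E j)) (length (E j))) (pad_cols (length ?r) (?X j))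
      (0\<^sub>m (length ?r) (length (E j))) (coord_mat A ?r ?r)"
    using step.hyps
    by (simp add: upt_conv_Cons[of j k] Let_def del: upt_Suc map_append concat_append length_append)
  also have "\<dots> = coord_mat A (E j @ ?r) (E j @ ?r)"
    by (simp only: coord_mat_append[of A "E j" ?r "E j" ?r] 1 2 3)
  also have "E j @ ?r = concat (map E [j..<Suc k]) @ W"
    using step.hyps by (simp add: upt_conv_Cons[of j "Suc k"] del: upt_Suc)
  finally show ?case .
qed

text \<open>The Gram matrix of the columns, written as a sum over \<open>bs\<close> so that Parseval
  can turn it into an inner product of two images under \<open>A\<close>.\<close>

lemma mat_adjoint_mult_coord_mat:
  assumes A: "A \<in> carrier_mat n n" and "set bs \<subseteq> carrier_vec n" "set cs \<subseteq> carrier_vec n"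
    and ij: "i < length cs" "j < length cs"
  shows "(mat_adjoint (coord_mat A bs cs) * coord_mat A bs cs) $$ (i, j) =
    (\<Sum>b\<leftarrow>bs. ((A *\<^sub>v cs ! j) \<bullet>c b) * (b \<bullet>c (A *\<^sub>v cs ! i)))"
proof -
  let ?X = "coord_mat A bs cs"
  have X: "?X \<in> carrier_mat (length bs) (length cs)" by simp
  have "(mat_adjoint ?X * ?X) $$ (i, j) = col ?X j \<bullet>c col ?X i"
    by (rule mat_adjoint_mult_index[OF X X ij])
  also have "\<dots> = (\<Sum>p\<in>{0..<length bs}. ((A *\<^sub>v cs ! j) \<bullet>c bs ! p) * cnj ((A *\<^sub>v cs ! i) \<bullet>c bs ! p))"
    using ij by (auto simp: scalar_prod_def intro!: sum.cong)
  also have "\<dots> = (\<Sum>p\<in>{0..<length bs}. ((A *\<^sub>v cs ! j) \<bullet>c bs ! p) * (bs ! p \<bullet>c (A *\<^sub>v cs ! i)))"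
  proof (intro sum.cong refl arg_cong2[where f = "(*)"])
    fix p assume "p \<in> {0..<length bs}"
    hence "bs ! p \<in> carrier_vec n" "cs ! i \<in> carrier_vec n" using assms by auto
    thus "cnj ((A *\<^sub>v cs ! i) \<bullet>c bs ! p) = bs ! p \<bullet>c (A *\<^sub>v cs ! i)"
      using A cscalar_prod_commute[of "bs ! p" n "A *\<^sub>v cs ! i"] by simp
  qed
  finally show ?thesis by (simp add: sum_list_sum_nth)
qed

text \<open>In the squared norm of \<open>x + a y\<close>, the value \<open>a = 1\<close> isolates
  the real part of the inner product and \<open>a = \<i>\<close> the imaginary part.\<close>

lemma polarization:
  assumes S: "vsubspace n S" and M: "M \<in> carrier_mat r n"
    and iso: "\<And>x. x \<in> S \<Longrightarrow> (M *\<^sub>v x) \<bullet>c (M *\<^sub>v x) = x \<bullet>c x"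
    and x: "x \<in> S" and y: "y \<in> S"
  shows "(M *\<^sub>v x) \<bullet>c (M *\<^sub>v y) = x \<bullet>c y"
proof -
  have xy: "x \<in> carrier_vec n" "y \<in> carrier_vec n" "M *\<^sub>v x \<in> carrier_vec r" "M *\<^sub>v y \<in> carrier_vec r"
    using x y M vsubspaceD(5)[OF S] by auto
  have expand: "(u + a \<cdot>\<^sub>v v) \<bullet>c (u + a \<cdot>\<^sub>v v) = u \<bullet>c u + cnj a * (u \<bullet>c v) + a * cnj (u \<bullet>c v) + a * cnj a * (v \<bullet>c v)"
    if "u \<in> carrier_vec m" "v \<in> carrier_vec m" for u v :: "complex vec" and a m
    using that cscalar_prod_add_left[of u m "a \<cdot>\<^sub>v v" "u + a \<cdot>\<^sub>v v"]
      cscalar_prod_add_right[of u m u "a \<cdot>\<^sub>v v"] cscalar_prod_add_right[of v m u "a \<cdot>\<^sub>v v"]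
      cscalar_prod_smult_left[of v m "u + a \<cdot>\<^sub>v v" a] cscalar_prod_smult_right[of u m v a]
      cscalar_prod_smult_right[of v m v a] cscalar_prod_commute[of v m u]
    by (simp add: algebra_simps)
  have *: "cnj a * ((M *\<^sub>v x) \<bullet>c (M *\<^sub>v y)) + a * cnj ((M *\<^sub>v x) \<bullet>c (M *\<^sub>v y))
      = cnj a * (x \<bullet>c y) + a * cnj (x \<bullet>c y)" for a
  proof -
    have "M *\<^sub>v (x + a \<cdot>\<^sub>v y) = M *\<^sub>v x + a \<cdot>\<^sub>v (M *\<^sub>v y)"
      using xy by (simp add: mult_add_distrib_mat_vec[OF M] mult_mat_vec[OF M])
    moreover have "x + a \<cdot>\<^sub>v y \<in> S" using x y vsubspaceD[OF S] by auto
    ultimately show ?thesis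
      using iso[of "x + a \<cdot>\<^sub>v y"] iso[OF x] iso[OF y] expand[OF xy(1,2), of a] expand[OF xy(3,4), of a]
      by simp
  qed
  from *[of 1] *[of \<i>] show ?thesis by (auto simp: complex_eq_iff)
qed

section \<open>Powers that are partial isometries\<close>

locale square_mat =
  fixes A :: "complex mat" and n :: nat
  assumes A: "A \<in> carrier_mat n n"
begin

lemma pow [simp]: "A ^\<^sub>m j \<in> carrier_mat n n"
  using A by simp

lemma A_carrier [simp]: "x \<in> carrier_vec n \<Longrightarrow> A *\<^sub>v x \<in> carrier_vec n"
  using A by simp

lemma pow_vec_carrier [simp]: "x \<in> carrier_vec n \<Longrightarrow> A ^\<^sub>m j *\<^sub>v x \<in> carrier_vec n"
  by (rule mult_mat_vec_carrier[OF pow])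

lemma pow_0_vec [simp]: "x \<in> carrier_vec n \<Longrightarrow> A ^\<^sub>m 0 *\<^sub>v x = x"
  using A by simp

lemma pow_Suc_vec: "x \<in> carrier_vec n \<Longrightarrow> A ^\<^sub>m Suc j *\<^sub>v x = A ^\<^sub>m j *\<^sub>v (A *\<^sub>v x)"
  using A by (simp add: assoc_mult_mat_vec[of _ n n _ n])

lemma pow_add_vec: "x \<in> carrier_vec n \<Longrightarrow> A ^\<^sub>m (i + j) *\<^sub>v x = A ^\<^sub>m i *\<^sub>v (A ^\<^sub>m j *\<^sub>v x)"
proof (induction j arbitrary: x)
  case 0
  thus ?case by (simp del: pow_mat.simps)
next
  case (Suc j)
  thus ?case using pow_Suc_vec[of x "i + j"] pow_Suc_vec[of x j] by (simp del: pow_mat.simps)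
qed

text \<open>The recursion of \<open>^\<^sub>m\<close> puts the new factor on the right; following a
  vector down the layers needs it on the left.\<close>

lemma pow_Suc_vec': "x \<in> carrier_vec n \<Longrightarrow> A ^\<^sub>m Suc j *\<^sub>v x = A *\<^sub>v (A ^\<^sub>m j *\<^sub>v x)"
  using pow_add_vec[of x 1 j] A by simp

lemma pow_zero_vec [simp]: "A ^\<^sub>m j *\<^sub>v 0\<^sub>v n = 0\<^sub>v n"
proof -
  have "M *\<^sub>v 0\<^sub>v n = 0\<^sub>v n" if "M \<in> carrier_mat n n" for M :: "complex mat"
    using that by (intro eq_vecI) auto
  thus ?thesis by simp
qed

end

locale partial_isometry_powers = square_mat A n for A n +
  fixes k :: nat
  assumes k: "1 \<le> k"
    and pi: "\<And>j. j \<in> {1..k} \<Longrightarrow> partial_isometry (A ^\<^sub>m j)"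
begin

section \<open>Kernels of the powers, their layers and their complements\<close>

definition K :: "nat \<Rightarrow> complex vec set" where
  "K j = mat_kernel (A ^\<^sub>m j)"

text \<open>Since \<open>0 - 1 = 0\<close>, the layer \<open>H 0\<close> is the zero space; this
  lets \<open>A_H\<close> and \<open>pow_H\<close> include the last step, from layer 1 to
  zero.\<close>

definition H :: "nat \<Rightarrow> complex vec set" where
  "H j = orth_diff (K j) (K (j - 1))"

definition R :: "nat \<Rightarrow> complex vec set" where
  "R j = orth_diff (carrier_vec n) (K j)"

lemma K_iff: "x \<in> K j \<longleftrightarrow> x \<in> carrier_vec n \<and> A ^\<^sub>m j *\<^sub>v x = 0\<^sub>v n"
  unfolding K_def mat_kernel[OF pow] by simp

lemma K_carrier: "K j \<subseteq> carrier_vec n"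
  by (auto simp: K_iff)

lemma K_vsubspace: "vsubspace n (K j)"
  unfolding K_def by (rule vsubspace_mat_kernel[OF pow])

lemma K_0: "K 0 = {0\<^sub>v n}"
  by (auto simp: K_iff simp del: pow_mat.simps)

lemma K_mono: "i \<le> j \<Longrightarrow> K i \<subseteq> K j"
  using pow_add_vec[of _ "j - i" i] by (auto simp: K_iff)

lemma A_K_iff: "x \<in> carrier_vec n \<Longrightarrow> A *\<^sub>v x \<in> K j \<longleftrightarrow> x \<in> K (Suc j)"
  by (simp add: K_iff pow_Suc_vec del: pow_mat.simps)

lemma H_vsubspace: "vsubspace n (H j)"
  unfolding H_def by (intro vsubspace_orth_diff K_vsubspace K_carrier)

lemma R_vsubspace: "vsubspace n (R j)"
  unfolding R_def by (intro vsubspace_orth_diff vsubspace_carrier K_carrier)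

lemma H_carrier: "x \<in> H j \<Longrightarrow> x \<in> carrier_vec n"
  using vsubspaceD(5)[OF H_vsubspace] .

lemma R_carrier: "x \<in> R j \<Longrightarrow> x \<in> carrier_vec n"
  using vsubspaceD(5)[OF R_vsubspace] .

lemma R_antimono: "i \<le> j \<Longrightarrow> R j \<subseteq> R i"
  using K_mono[of i j] by (auto simp: R_def orth_diff_def)

lemma R_0: "R 0 = carrier_vec n"
  by (auto simp: R_def orth_diff_def K_0)

lemma H_subset_K: "H j \<subseteq> K j"
  by (auto simp: H_def orth_diff_def)

lemma H_subset_R: "H j \<subseteq> R (j - 1)"
  using K_carrier by (auto simp: H_def R_def orth_diff_def)

lemma R_orth_K: "x \<in> R j \<Longrightarrow> y \<in> K j \<Longrightarrow> x \<bullet>c y = 0"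
  by (auto simp: R_def orth_diff_def)

lemma H_orth_R: "x \<in> H i \<Longrightarrow> y \<in> R j \<Longrightarrow> i \<le> j \<Longrightarrow> x \<bullet>c y = 0"
  using R_orth_K[of y j x] H_subset_K[of i] K_mono[of i j] cscalar_prod_eq_0_commute[of x n y]
    H_carrier R_carrier by blast

lemma H_orth_H: "x \<in> H i \<Longrightarrow> y \<in> H j \<Longrightarrow> i \<noteq> j \<Longrightarrow> x \<bullet>c y = 0"
proof (induction i j arbitrary: x y rule: linorder_wlog)
  case (le i j)
  hence "y \<in> R (j - 1)" "i \<le> j - 1" using H_subset_R by auto
  thus ?case using H_orth_R le by blast
next
  case (sym i j)
  thus ?case using cscalar_prod_eq_0_commute[of x n y] H_carrier by metis
qed

text \<open>\<open>R j\<close> is \<open>ker_perp\<close> of the power, where a partial isometry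
  preserves norms; \<open>j = 0\<close> is the identity and lies outside the range of the
  assumption.\<close>

lemma R_isometry_self:
  assumes "x \<in> R j" "j \<le> k"
  shows "(A ^\<^sub>m j *\<^sub>v x) \<bullet>c (A ^\<^sub>m j *\<^sub>v x) = x \<bullet>c x"
proof (cases "j = 0")
  case True
  thus ?thesis using R_carrier[OF assms(1)] by (simp del: pow_mat.simps)
next
  case False
  have "x \<in> ker_perp (A ^\<^sub>m j)"
    using assms(1) carrier_matD[OF pow[of j]] by (auto simp: ker_perp_def R_def orth_diff_def K_def)
  thus ?thesis
    using False assms(2) pi[of j] vec_l2norm_eq_iff[of "A ^\<^sub>m j *\<^sub>v x" x] by (auto simp: partial_isometry_def)
qed

lemma R_isometry:
  assumes "x \<in> R j" "y \<in> R j" "j \<le> k"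
  shows "(A ^\<^sub>m j *\<^sub>v x) \<bullet>c (A ^\<^sub>m j *\<^sub>v y) = x \<bullet>c y"
  using polarization[OF R_vsubspace pow R_isometry_self[OF _ assms(3)] assms(1,2)] .

lemma R_isometry_A:
  assumes "x \<in> R 1" "y \<in> R 1"
  shows "(A *\<^sub>v x) \<bullet>c (A *\<^sub>v y) = x \<bullet>c y"
  using R_isometry[OF assms k] A by simp

text \<open>The projection of \<open>A x\<close> to \<open>ker A\<^sup>j\<close> vanishes because \<open>A\<^sup>j\<close> preserves the norm of the
  remaining part, which is therefore as long as \<open>A\<^sup>j\<^sup>+\<^sup>1 x\<close>, \<open>x\<close> and \<open>A x\<close>.\<close>

lemma A_R:
  assumes x: "x \<in> R (Suc j)" and j: "Suc j \<le> k"
  shows "A *\<^sub>v x \<in> R j"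
proof -
  have xc: "x \<in> carrier_vec n" using R_carrier[OF x] .
  obtain bs where bs: "onb n (K j) bs" using onb_exists[OF K_vsubspace] .
  hence o: "orthonormal n bs" "set bs \<subseteq> carrier_vec n" "set bs \<subseteq> K j"
    by (auto simp: onb_def orthonormal_def)
  define u v where "u = proj n bs (A *\<^sub>v x)" and "v = A *\<^sub>v x - u"
  have u: "u \<in> K j" unfolding u_def by (rule proj_mem[OF K_vsubspace o(3)])
  hence uc: "u \<in> carrier_vec n" using K_carrier by blast
  hence vc: "v \<in> carrier_vec n" using xc by (simp add: v_def)
  have Ax: "A *\<^sub>v x = u + v" using uc xc A by (intro eq_vecI) (auto simp: v_def)
  have v_orth: "v \<bullet>c y = 0" if "y \<in> K j" for y
    using onb_orthogonal[OF bs K_vsubspace vc _ that] diff_proj_orthogonal[OF o(1)] xc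
    by (auto simp: v_def u_def)
  have v: "v \<in> R j" using vc v_orth by (auto simp: R_def orth_diff_def)
  have "A ^\<^sub>m Suc j *\<^sub>v x = A ^\<^sub>m j *\<^sub>v u + A ^\<^sub>m j *\<^sub>v v"
    unfolding pow_Suc_vec[OF xc] Ax using uc vc by (simp add: mult_add_distrib_mat_vec[OF pow])
  also have "\<dots> = A ^\<^sub>m j *\<^sub>v v" using u vc by (simp add: K_iff)
  finally have "v \<bullet>c v = x \<bullet>c x"
    using R_isometry_self[OF x j] R_isometry_self[OF v] j by simp
  also have "\<dots> = (A *\<^sub>v x) \<bullet>c (A *\<^sub>v x)"
    using R_isometry_A[of x x] x R_antimono[of 1 "Suc j"] by auto
  also have "\<dots> = u \<bullet>c u + v \<bullet>c v"
    unfolding Ax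
    using uc vc v_orth[OF u] cscalar_prod_eq_0_commute[OF uc vc] cscalar_prod_add_left[OF uc vc, of "u + v"]
      cscalar_prod_add_right[OF uc uc vc] cscalar_prod_add_right[OF vc uc vc] by simp
  finally have "u = 0\<^sub>v n" using uc by simp
  thus ?thesis using Ax v vc by simp
qed

text \<open>A layer is the intersection of a kernel with a complement. \<open>A\<close> lowers the
  kernels by one trivially and the complements by one by \<open>A_R\<close>.\<close>

lemma A_H:
  assumes "x \<in> H j" "1 \<le> j" "j \<le> k"
  shows "A *\<^sub>v x \<in> H (j - 1)"
proof -
  have "A *\<^sub>v x \<in> K (j - 1)"
    using assms A_K_iff[of x "j - 1"] H_subset_K[of j] H_carrier by auto
  moreover have "A *\<^sub>v x \<in> R (j - 1 - 1)"
  proof (cases "j = 1")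
    \<comment> \<open>Here \<open>j - 1 - 1 = 0\<close> by truncation, and \<open>R 0\<close> is the
      whole space.\<close>
    case True
    thus ?thesis using H_carrier[OF assms(1)] by (simp add: R_0)
  next
    case False
    hence "j = Suc (Suc (j - 2))" using assms(2) by simp
    then obtain i where "j = Suc (Suc i)" ..
    thus ?thesis using assms A_R[of x i] H_subset_R[of j] by auto
  qed
  ultimately show ?thesis by (auto simp: H_def R_def orth_diff_def)
qed

lemma pow_H:
  assumes "x \<in> H j" "a \<le> j" "j \<le> k"
  shows "A ^\<^sub>m a *\<^sub>v x \<in> H (j - a)"
  using assms(2)
proof (induction a)
  case 0
  thus ?case using assms H_carrier by (simp del: pow_mat.simps)
next
  case (Suc a)
  thus ?case
    using A_H[of "A ^\<^sub>m a *\<^sub>v x" "j - a"] assms H_carrier by (simp add: pow_Suc_vec' del: pow_mat.simps)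
qed

lemma pow_H_eq_0:
  assumes "x \<in> H j"
  shows "A ^\<^sub>m j *\<^sub>v x = 0\<^sub>v n"
  using subsetD[OF H_subset_K assms] by (simp add: K_iff)

section \<open>Orthonormal bases of the layers and form (b)\<close>

definition E :: "nat \<Rightarrow> complex vec list" where
  "E j = (SOME bs. onb n (H j) bs)"

definition W :: "complex vec list" where
  "W = (SOME bs. onb n (R k) bs)"

lemma onb_E: "onb n (H j) (E j)"
  unfolding E_def using onb_exists[OF H_vsubspace] by (metis someI)

lemma onb_W: "onb n (R k) W"
  unfolding W_def using onb_exists[OF R_vsubspace] by (metis someI)

lemma E_H: "e \<in> set (E j) \<Longrightarrow> e \<in> H j"
  using onb_E[of j] by (auto simp: onb_def)

lemma W_R: "w \<in> set W \<Longrightarrow> w \<in> R k"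
  using onb_W by (auto simp: onb_def)

lemma onb_K: "onb n (K j) (concat (map E [1..<Suc j]))"
proof (induction j)
  case 0
  show ?case by (simp add: onb_def orthonormal_Nil K_0)
next
  case (Suc j)
  have "onb n (K (Suc j)) (concat (map E [1..<Suc j]) @ E (Suc j))"
    using Suc onb_E[of "Suc j"]
    by (intro onb_orth_diff_append[OF K_vsubspace K_mono K_carrier]) (simp_all add: H_def)
  thus ?case by simp
qed

lemma onb_total: "onb n (carrier_vec n) (concat (map E [1..<Suc k]) @ W)"
  using onb_K[of k] onb_W
  by (intro onb_orth_diff_append[OF K_vsubspace K_carrier]) (simp_all add: R_def)

text \<open>Dropping the first \<open>k - 1\<close> layers from the full basis leaves a basis of
  their complement. By \<open>A_R\<close> this complement receives the images of
  \<open>W\<close>.\<close>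

lemma onb_EW: "onb n (R (k - 1)) (E k @ W)"
proof -
  have kk: "[1..<Suc k] = [1..<Suc (k - 1)] @ [k]" using k by (cases k) auto
  have tot: "onb n (carrier_vec n) (concat (map E [1..<Suc (k - 1)]) @ E k @ W)"
    using onb_total unfolding kk by simp
  have "x = 0\<^sub>v n" if "x \<in> R (k - 1)" "\<forall>b \<in> set (E k @ W). x \<bullet>c b = 0" for x
  proof -
    have "x \<bullet>c b = 0" if "b \<in> set (concat (map E [1..<Suc (k - 1)]))" for b
    proof -
      have "b \<in> K (k - 1)" using that onb_K[of "k - 1"] unfolding onb_def by blast
      thus ?thesis by (rule R_orth_K[OF \<open>x \<in> R (k - 1)\<close>])
    qed
    moreover have "x \<in> carrier_vec n" using that(1) by (rule R_carrier)
    ultimately show ?thesis using that(2) tot unfolding onb_def set_append by blast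
  qed
  moreover have "set (E k @ W) \<subseteq> R (k - 1)"
    using E_H[of _ k] W_R H_subset_R[of k] R_antimono[of "k - 1" k] by auto
  ultimately show ?thesis using tot unfolding onb_def orthonormal_append by blast
qed

lemma kernel_dim_pow: "kernel_dim (A ^\<^sub>m j) = (\<Sum>t=1..j. length (E t))"
proof -
  have "kernel_dim (A ^\<^sub>m j) = length (concat (map E [1..<Suc j]))"
    using kernel_dim_eq_length_onb[OF pow, of j] onb_K[of j] unfolding K_def by simp
  also have "\<dots> = (\<Sum>t\<leftarrow>[1..<Suc j]. length (E t))" by (simp add: length_concat comp_def)
  also have "\<dots> = (\<Sum>t=1..j. length (E t))"
    by (subst sum_list_distinct_conv_sum_set) (simp_all add: atLeastLessThanSuc_atLeastAtMost del: upt_Suc)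
  finally show ?thesis .
qed

lemma length_W: "(\<Sum>j=1..k. length (E j)) + length W = n"
  using onb_carrier_length[OF onb_total] kernel_dim_pow[of k]
    kernel_dim_eq_length_onb[OF pow, of k] onb_K[of k] by (simp add: K_def)

lemma kernel_block_sizes_E: "kernel_block_sizes A k (\<lambda>j. length (E j)) (length W)"
proof -
  have "kernel_dim A = length (E 1)" using kernel_dim_pow[of 1] A by simp
  moreover have "length (E j) = kernel_dim (A ^\<^sub>m j) - kernel_dim (A ^\<^sub>m (j - 1))" if "j \<in> {2..k}" for j
  proof -
    have "j = Suc (j - 1)" using that by simp
    then obtain i where "j = Suc i" ..
    thus ?thesis unfolding kernel_dim_pow by simp
  qed
  moreover have "vec_space.rank n (A ^\<^sub>m k) = length W"
    using rank_nullity_mat[OF pow, of k] length_W kernel_dim_pow[of k] by simp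
  ultimately show ?thesis using A by (auto simp: kernel_block_sizes_def)
qed

text \<open>By Parseval in \<open>S\<close> the sum is the inner product of two images, and
  \<open>A\<close> preserves inner products on \<open>R 1\<close>.\<close>

lemma isometric_cols:
  assumes "onb n S bs" "vsubspace n S" "orthonormal n cs"
    and "\<And>c. c \<in> set cs \<Longrightarrow> c \<in> R 1 \<and> A *\<^sub>v c \<in> S"
    and "i < length cs" "j < length cs"
  shows "(\<Sum>b\<leftarrow>bs. ((A *\<^sub>v cs ! j) \<bullet>c b) * (b \<bullet>c (A *\<^sub>v cs ! i))) = (if i = j then 1 else 0)"
proof -
  have c: "cs ! i \<in> R 1" "cs ! j \<in> R 1" "A *\<^sub>v cs ! j \<in> S" using assms by auto
  hence "(\<Sum>b\<leftarrow>bs. ((A *\<^sub>v cs ! j) \<bullet>c b) * (b \<bullet>c (A *\<^sub>v cs ! i))) = (A *\<^sub>v cs ! j) \<bullet>c (A *\<^sub>v cs ! i)"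
    using R_carrier by (intro parseval[OF assms(1,2), symmetric]) auto
  also have "\<dots> = cs ! j \<bullet>c cs ! i" by (rule R_isometry_A[OF c(2,1)])
  finally show ?thesis using assms(5,6) orthonormal_nth[OF assms(3)] by simp
qed

text \<open>The images of \<open>W\<close> are expanded in the basis \<open>E k @ W\<close>; the two
  parts of this basis contribute the Gram matrices of \<open>B\<close> and of
  \<open>C\<close>.\<close>

lemma coord_mat_W_isometric:
  "mat_adjoint (coord_mat A (E k) W) * coord_mat A (E k) W + mat_adjoint (coord_mat A W W) * coord_mat A W W
     = 1\<^sub>m (length W)"
proof (rule eq_matI)
  fix i j assume "i < dim_row (1\<^sub>m (length W) :: complex mat)" "j < dim_col (1\<^sub>m (length W) :: complex mat)"
  hence ij: "i < length W" "j < length W" by auto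
  have c: "set W \<subseteq> carrier_vec n" "set (E k) \<subseteq> carrier_vec n"
    by (auto intro: R_carrier[OF W_R] H_carrier[OF E_H])
  have "w \<in> R 1 \<and> A *\<^sub>v w \<in> R (k - 1)" if "w \<in> set W" for w
    using W_R[OF that] A_R[of w "k - 1"] R_antimono[OF k] k by auto
  from isometric_cols[OF onb_EW R_vsubspace _ this ij] onb_W
  have "(\<Sum>b\<leftarrow>E k @ W. ((A *\<^sub>v W ! j) \<bullet>c b) * (b \<bullet>c (A *\<^sub>v W ! i))) = (if i = j then 1 else 0)"
    by (auto simp: onb_def)
  thus "(mat_adjoint (coord_mat A (E k) W) * coord_mat A (E k) W + mat_adjoint (coord_mat A W W) * coord_mat A W W) $$ (i, j)
    = 1\<^sub>m (length W) $$ (i, j)"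
    using ij mat_adjoint_mult_coord_mat[OF A c(2,1) ij] mat_adjoint_mult_coord_mat[OF A c(1,1) ij]
    by (simp add: mat_adjoint_def del: index_mult_mat(1))
qed (auto simp: mat_adjoint_def)

lemma coord_mat_E_isometric:
  assumes "j \<in> {1..<k}"
  shows "mat_adjoint (coord_mat A (E j) (E (Suc j))) * coord_mat A (E j) (E (Suc j)) = 1\<^sub>m (length (E (Suc j)))"
proof (rule eq_matI)
  fix p q
  assume "p < dim_row (1\<^sub>m (length (E (Suc j))) :: complex mat)" "q < dim_col (1\<^sub>m (length (E (Suc j))) :: complex mat)"
  hence pq: "p < length (E (Suc j))" "q < length (E (Suc j))" by auto
  have c: "set (E i) \<subseteq> carrier_vec n" for i by (auto intro: H_carrier[OF E_H])
  have "e \<in> R 1 \<and> A *\<^sub>v e \<in> H j" if "e \<in> set (E (Suc j))" for e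
    using E_H[OF that] A_H[of e "Suc j"] H_subset_R[of "Suc j"] R_antimono[of 1 j] assms by auto
  from isometric_cols[OF onb_E H_vsubspace _ this pq] onb_E
  show "(mat_adjoint (coord_mat A (E j) (E (Suc j))) * coord_mat A (E j) (E (Suc j))) $$ (p, q) = 1\<^sub>m (length (E (Suc j))) $$ (p, q)"
    using pq mat_adjoint_mult_coord_mat[OF A c c pq] by (auto simp: onb_def simp del: index_mult_mat(1))
qed (auto simp: mat_adjoint_def)

text \<open>The zero pattern depends only on the layers containing the vectors. It is used with
  whole bases \<open>E t\<close> for form (b), and with the layers of the chains of length
  \<open>k\<close> alone for form (c).\<close>

lemma superdiag_mat_levels:
  assumes M: "\<And>t. t \<in> {1..k} \<Longrightarrow> set (M t) \<subseteq> H t"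
  shows "superdiag_mat (map (\<lambda>i. coord_mat A (M i) (M (Suc i))) [1..<k] @ [coord_mat A (M k) W]) (coord_mat A W W)
    = coord_mat A (concat (map M [1..<Suc k]) @ W) (concat (map M [1..<Suc k]) @ W)"
proof (rule superdiag_mat_coord_mat)
  fix i t e f assume "i \<in> {1..k}" "t \<in> {1..k}" "t \<noteq> Suc i" "e \<in> set (M i)" "f \<in> set (M t)"
  hence "f \<in> H t" "e \<in> H i" "t - 1 \<noteq> i" "1 \<le> t" "t \<le> k" using M by auto
  thus "(A *\<^sub>v f) \<bullet>c e = 0" using A_H H_orth_H by blast
next
  fix i e w assume "i \<in> {1..<k}" "e \<in> set (M i)" "w \<in> set W"
  hence "e \<in> H i" "i \<le> k - 1" "A *\<^sub>v w \<in> R (k - 1)"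
    using M[of i] A_R[of w "k - 1"] W_R by auto
  thus "(A *\<^sub>v w) \<bullet>c e = 0"
    using R_orth_K subsetD[OF K_mono[of i "k - 1"] subsetD[OF H_subset_K]] by blast
next
  fix i e w assume "i \<in> {1..k}" "e \<in> set (M i)" "w \<in> set W"
  hence "e \<in> H i" "1 \<le> i" "i \<le> k" "i - 1 \<le> k" "w \<in> R k" using M[of i] W_R by auto
  thus "(A *\<^sub>v e) \<bullet>c w = 0" using A_H H_orth_R by blast
qed (use k in auto)

lemma isometric_block_form_E:
  "isometric_block_form A k (\<lambda>j. length (E j)) (length W)
     (\<lambda>j. coord_mat A (E j) (E (Suc j))) (coord_mat A (E k) W) (coord_mat A W W)"
proof -
  have "unitary_similar A
    (superdiag_mat (map (\<lambda>i. coord_mat A (E i) (E (Suc i))) [1..<k] @ [coord_mat A (E k) W]) (coord_mat A W W))"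
    using unitary_similar_coord_mat[OF A onb_total] by (subst superdiag_mat_levels) (auto intro: E_H)
  moreover have "mat_adjoint (coord_mat A (E j) (E (j + 1))) * coord_mat A (E j) (E (j + 1)) = 1\<^sub>m (length (E (j + 1)))"
    if "j \<in> {1..k - 1}" for j
  proof -
    have "j \<in> {1..<k}" using that k by auto
    from coord_mat_E_isometric[OF this] show ?thesis by simp
  qed
  ultimately show ?thesis
    unfolding isometric_block_form_def
    using A length_W coord_mat_W_isometric by (intro conjI ballI) simp_all
qed

end

section \<open>Jordan chains\<close>

lemma coord_mat_concat_diag:
  assumes "sorted_wrt (\<lambda>bs cs. \<forall>b \<in> set bs. \<forall>c \<in> set cs. (A *\<^sub>v c) \<bullet>c b = 0 \<and> (A *\<^sub>v b) \<bullet>c c = 0) bss"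
  shows "coord_mat A (concat bss) (concat bss) = diag_block_mat (map (\<lambda>bs. coord_mat A bs bs) bss)"
  using assms
proof (induction bss)
  case Nil
  show ?case by (intro eq_matI) auto
next
  case (Cons bs bss)
  have "coord_mat A bs (concat bss) = 0\<^sub>m (length bs) (length (concat bss))"
    "coord_mat A (concat bss) bs = 0\<^sub>m (length (concat bss)) (length bs)"
    using Cons.prems by (auto intro!: coord_mat_eq_0)
  thus ?case using Cons by (simp add: coord_mat_append flip: Cons.IH)
qed

text \<open>Abel summation: a staircase whose \<open>j\<close>-th row has \<open>d j\<close> cells
  is counted by columns, \<open>d k\<close> of them of length \<open>k\<close> and
  \<open>d j - d (Suc j)\<close> of length \<open>j < k\<close>.\<close>

lemma sum_telescope_mult:
  fixes d :: "nat \<Rightarrow> nat"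
  assumes "\<And>j. j \<in> {1..<k} \<Longrightarrow> d (Suc j) \<le> d j"
  shows "k * d k + (\<Sum>j=1..<k. (d j - d (Suc j)) * j) = (\<Sum>j=1..k. d j)"
  using assms
proof (induction k)
  case (Suc k)
  show ?case
  proof (cases "k = 0")
    case False
    have "d (Suc k) \<le> d k" using Suc.prems[of k] False by simp
    then obtain c where "d k = d (Suc k) + c" using le_Suc_ex by blast
    hence "(d k - d (Suc k)) * k + k * d (Suc k) = k * d k"
      by (simp add: algebra_simps)
    moreover have "k * d k + (\<Sum>j=1..<k. (d j - d (Suc j)) * j) = (\<Sum>j=1..k. d j)"
      using Suc by simp
    moreover have "{1..<Suc k} = insert k {1..<k}" using False by auto
    ultimately show ?thesis by simp
  qed simp
qed simp

lemma sum_list_concat: "sum_list (concat xss) = (\<Sum>xs\<leftarrow>xss. sum_list xs)"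
  by (induction xss) simp_all

context partial_isometry_powers
begin

text \<open>Only the span of the image of the next layer matters for choosing new tops, so the image
  of the fixed basis \<open>E (Suc j)\<close> serves, and no basis has to be carried down the layers
  recursively.\<close>

definition F :: "nat \<Rightarrow> complex vec list" where
  "F j = (SOME fs. onb n (H j) (map (\<lambda>e. A *\<^sub>v e) (E (Suc j)) @ fs))"

lemma onb_F:
  assumes "j \<in> {1..<k}"
  shows "onb n (H j) (map (\<lambda>e. A *\<^sub>v e) (E (Suc j)) @ F j)"
proof -
  have E1: "e \<in> R 1" "A *\<^sub>v e \<in> H j" if "e \<in> set (E (Suc j))" for e
    using E_H[OF that] A_H[of e "Suc j"] H_subset_R[of "Suc j"] R_antimono[of 1 j] assms by auto
  have "orthonormal n (map (\<lambda>e. A *\<^sub>v e) (E (Suc j)))"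
  proof (rule orthonormalI_nth)
    show "set (map (\<lambda>e. A *\<^sub>v e) (E (Suc j))) \<subseteq> carrier_vec n"
      using E1(2) H_carrier by auto
    fix p q assume "p < length (map (\<lambda>e. A *\<^sub>v e) (E (Suc j)))" "q < length (map (\<lambda>e. A *\<^sub>v e) (E (Suc j)))"
    thus "map (\<lambda>e. A *\<^sub>v e) (E (Suc j)) ! p \<bullet>c map (\<lambda>e. A *\<^sub>v e) (E (Suc j)) ! q = (if p = q then 1 else 0)"
      using onb_E[of "Suc j"] orthonormal_nth[of n "E (Suc j)" p q] R_isometry_A E1
      by (simp add: onb_def)
  qed
  moreover have "set (map (\<lambda>e. A *\<^sub>v e) (E (Suc j))) \<subseteq> H j" using E1(2) by auto
  ultimately obtain fs where "onb n (H j) (map (\<lambda>e. A *\<^sub>v e) (E (Suc j)) @ fs)"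
    using onb_extend[OF H_vsubspace] by metis
  thus ?thesis unfolding F_def by (rule someI)
qed

lemma length_F:
  assumes "j \<in> {1..<k}"
  shows "length (E (Suc j)) + length (F j) = length (E j)"
  using onb_length_unique[OF onb_F[OF assms] onb_E H_vsubspace] by simp

text \<open>A top vector of height \<open>i\<close> generates a Jordan chain of length \<open>i\<close> that cannot be
  prolonged to length \<open>i + 1\<close> within the first \<open>k\<close> levels.\<close>

definition top_vec :: "nat \<Rightarrow> complex vec \<Rightarrow> bool" where
  "top_vec i f \<longleftrightarrow> i \<in> {1..k} \<and> f \<in> H i \<and> (i < k \<longrightarrow> (\<forall>x \<in> H (Suc i). (A *\<^sub>v x) \<bullet>c f = 0))"

text \<open>\<open>A x\<close> is a combination of the images of \<open>E (Suc j)\<close>, and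
  \<open>F j\<close> is orthogonal to these.\<close>

lemma top_vec_F:
  assumes j: "j \<in> {1..<k}" and f: "f \<in> set (F j)"
  shows "top_vec j f"
proof -
  note F = onb_F[OF j]
  have fH: "f \<in> H j" using F f by (auto simp: onb_def)
  hence fc: "f \<in> carrier_vec n" by (rule H_carrier)
  have "(A *\<^sub>v x) \<bullet>c f = 0" if x: "x \<in> H (Suc j)" for x
  proof -
    have c: "set (E (Suc j)) \<subseteq> carrier_vec n" by (auto intro: H_carrier[OF E_H])
    have "(A *\<^sub>v x) \<bullet>c f = (\<Sum>b\<leftarrow>E (Suc j). (x \<bullet>c b) * ((A *\<^sub>v b) \<bullet>c f))"
      using mult_mat_proj_cscalar_prod[OF c fc A, of x] proj_eq_self[OF onb_E H_vsubspace x] by simp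
    also have "\<dots> = 0"
      using F f by (intro sum_list_eq_zero) (auto simp: onb_def orthonormal_append)
    finally show ?thesis .
  qed
  thus ?thesis using fH j by (auto simp: top_vec_def)
qed

lemma top_vec_E: "e \<in> set (E k) \<Longrightarrow> top_vec k e"
  using k by (simp add: top_vec_def E_H)

lemma top_vecD:
  assumes "top_vec i f"
  shows "1 \<le> i" "i \<le> k" "f \<in> H i" "f \<in> carrier_vec n"
  using assms H_carrier by (auto simp: top_vec_def)

lemma top_vec_pow_H:
  assumes "top_vec i f" "a \<le> i"
  shows "A ^\<^sub>m a *\<^sub>v f \<in> H (i - a)"
  using pow_H top_vecD[OF assms(1)] assms(2) by blast

text \<open>\<open>A^a\<close> preserves inner products on \<open>R a\<close>, so the common power
  cancels and \<open>f\<close> is compared with \<open>A^(b-a) g\<close>. For \<open>b > a\<close>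
  the two lie in different layers, or the second is the image of a vector from the layer above
  \<open>f\<close>, to which a top vector is orthogonal.\<close>

lemma top_vec_inner_le:
  assumes f: "top_vec i f" and g: "top_vec j g" and "a < i" "b < j" "a \<le> b"
  shows "(A ^\<^sub>m a *\<^sub>v f) \<bullet>c (A ^\<^sub>m b *\<^sub>v g) = (if a = b then f \<bullet>c g else 0)"
proof -
  note f' = top_vecD[OF f] and g' = top_vecD[OF g]
  obtain c where b: "b = a + c" using assms(5) le_Suc_ex by blast
  define g1 where "g1 = A ^\<^sub>m c *\<^sub>v g"
  have g1: "g1 \<in> H (j - c)" unfolding g1_def using top_vec_pow_H[OF g] b assms(4) by simp
  have "A ^\<^sub>m b *\<^sub>v g = A ^\<^sub>m a *\<^sub>v g1" unfolding b g1_def by (rule pow_add_vec[OF g'(4)])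
  moreover have "f \<in> R a"
    by (rule subsetD[OF R_antimono subsetD[OF H_subset_R f'(3)]]) (use assms in auto)
  moreover have "g1 \<in> R a"
    by (rule subsetD[OF R_antimono subsetD[OF H_subset_R g1]]) (use assms b in auto)
  ultimately have eq: "(A ^\<^sub>m a *\<^sub>v f) \<bullet>c (A ^\<^sub>m b *\<^sub>v g) = f \<bullet>c g1"
    using R_isometry[of f a g1] f' assms(3) by simp
  show ?thesis
  proof (cases "c = 0")
    case True
    thus ?thesis using eq g' b by (simp add: g1_def del: pow_mat.simps)
  next
    case False
    have "f \<bullet>c g1 = 0"
    proof (cases "j - c = i")
      case False
      thus ?thesis using H_orth_H[OF f'(3) g1] by simp
    next
      case True
      \<comment> \<open>Since \<open>c > 0\<close> and \<open>j \<le> k\<close>, there is still a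
        layer above \<open>i\<close> within the first \<open>k\<close>.\<close>
      then have i: "i < k" "j - (c - 1) = Suc i" using \<open>c \<noteq> 0\<close> g'(2) assms(4) b by auto
      have "g1 = A *\<^sub>v (A ^\<^sub>m (c - 1) *\<^sub>v g)"
        unfolding g1_def using pow_Suc_vec'[OF g'(4), of "c - 1"] \<open>c \<noteq> 0\<close> by simp
      moreover have "A ^\<^sub>m (c - 1) *\<^sub>v g \<in> H (Suc i)"
        using top_vec_pow_H[OF g, of "c - 1"] i(2) b assms(4) by simp
      ultimately have "g1 \<bullet>c f = 0" using f i(1) by (simp add: top_vec_def)
      thus ?thesis using cscalar_prod_eq_0_commute[of g1 n f] H_carrier[OF g1] f'(4) by simp
    qed
    thus ?thesis using eq b \<open>c \<noteq> 0\<close> by simp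
  qed
qed

lemma top_vec_inner:
  assumes f: "top_vec i f" and g: "top_vec j g" and ab: "a < i" "b < j"
  shows "(A ^\<^sub>m a *\<^sub>v f) \<bullet>c (A ^\<^sub>m b *\<^sub>v g) = (if a = b then f \<bullet>c g else 0)"
proof (cases "a \<le> b")
  case True
  thus ?thesis using top_vec_inner_le[OF f g ab] by simp
next
  case False
  hence "(A ^\<^sub>m b *\<^sub>v g) \<bullet>c (A ^\<^sub>m a *\<^sub>v f) = 0" using top_vec_inner_le[OF g f ab(2,1)] by simp
  moreover have "A ^\<^sub>m b *\<^sub>v g \<in> carrier_vec n" "A ^\<^sub>m a *\<^sub>v f \<in> carrier_vec n"
    using top_vecD(4)[OF f] top_vecD(4)[OF g] by simp_all
  ultimately show ?thesis using False cscalar_prod_eq_0_commute by auto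
qed

text \<open>The condition \<open>b < i\<close> matters at the bottom of a chain: for
  \<open>Suc a = i\<close> the image is zero, although \<open>Suc a = b\<close> can hold when the
  other chain is longer.\<close>

lemma top_vec_A_inner:
  assumes f: "top_vec i f" and g: "top_vec j g" and ab: "a < i" "b < j"
  shows "(A *\<^sub>v (A ^\<^sub>m a *\<^sub>v f)) \<bullet>c (A ^\<^sub>m b *\<^sub>v g) = (if Suc a = b \<and> b < i then f \<bullet>c g else 0)"
proof -
  have 1: "A *\<^sub>v (A ^\<^sub>m a *\<^sub>v f) = A ^\<^sub>m Suc a *\<^sub>v f"
    using pow_Suc_vec'[OF top_vecD(4)[OF f]] by simp
  show ?thesis
  proof (cases "Suc a = i")
    case True
    hence "A ^\<^sub>m Suc a *\<^sub>v f = 0\<^sub>v n" using pow_H_eq_0 top_vecD(3)[OF f] by blast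
    moreover have "A ^\<^sub>m b *\<^sub>v g \<in> carrier_vec n" using top_vecD(4)[OF g] by simp
    ultimately show ?thesis unfolding 1 using True by auto
  next
    case False
    thus ?thesis unfolding 1 using top_vec_inner[OF f g, of "Suc a" b] ab by auto
  qed
qed

text \<open>Listed from the bottom \<open>A^(j-1) f\<close> up to the top \<open>f\<close>:
  \<open>A\<close> sends each vector to its predecessor, which puts the ones of the Jordan block
  above the diagonal.\<close>

definition chain :: "nat \<Rightarrow> complex vec \<Rightarrow> complex vec list" where
  "chain j f = map (\<lambda>t. A ^\<^sub>m (j - Suc t) *\<^sub>v f) [0..<j]"

lemma set_chainE:
  assumes "x \<in> set (chain j f)"
  obtains a where "a < j" "x = A ^\<^sub>m a *\<^sub>v f"
proof -
  from assms obtain t where "t < j" "x = A ^\<^sub>m (j - Suc t) *\<^sub>v f" by (auto simp: chain_def)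
  thus ?thesis by (intro that[of "j - Suc t"]) auto
qed

lemma chain_nth: "p < j \<Longrightarrow> chain j f ! p = A ^\<^sub>m (j - Suc p) *\<^sub>v f"
  by (simp add: chain_def)

lemma length_chain [simp]: "length (chain j f) = j"
  by (simp add: chain_def)

lemma orthonormal_chain:
  assumes "top_vec j f" "f \<bullet>c f = 1"
  shows "orthonormal n (chain j f)"
proof (rule orthonormalI_nth)
  show "set (chain j f) \<subseteq> carrier_vec n" using top_vecD(4)[OF assms(1)] by (auto elim!: set_chainE)
  fix p q assume "p < length (chain j f)" "q < length (chain j f)"
  thus "chain j f ! p \<bullet>c chain j f ! q = (if p = q then 1 else 0)"
    using top_vec_inner[OF assms(1) assms(1), of "j - Suc p" "j - Suc q"] assms(2)
    by (auto simp: chain_nth)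
qed

lemma coord_mat_chain:
  assumes "top_vec j f" "f \<bullet>c f = 1"
  shows "coord_mat A (chain j f) (chain j f) = jordan_block j 0"
proof (rule eq_matI)
  fix p q assume "p < dim_row (jordan_block j (0 :: complex))" "q < dim_col (jordan_block j (0 :: complex))"
  hence pq: "p < j" "q < j" by auto
  thus "coord_mat A (chain j f) (chain j f) $$ (p, q) = jordan_block j 0 $$ (p, q)"
    using top_vec_A_inner[OF assms(1) assms(1), of "j - Suc q" "j - Suc p"] assms(2)
    by (auto simp: chain_nth jordan_block_def)
qed auto

text \<open>The vectors at height \<open>t\<close> in the chains of length \<open>k\<close>.
  Collecting these chains by height rather than one by one gives identity blocks instead of Jordan
  blocks.\<close>

definition M :: "nat \<Rightarrow> complex vec list" where
  "M t = map (\<lambda>e. A ^\<^sub>m (k - t) *\<^sub>v e) (E k)"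

lemma length_M [simp]: "length (M t) = length (E k)"
  by (simp add: M_def)

lemma M_k: "M k = E k"
  unfolding M_def using H_carrier[OF E_H] by (simp add: map_idI del: pow_mat.simps)

lemma M_H: "t \<in> {1..k} \<Longrightarrow> set (M t) \<subseteq> H t"
  using top_vec_pow_H[OF top_vec_E, of _ "k - t"] by (auto simp: M_def)

lemma orthonormal_M:
  assumes "t \<in> {1..k}"
  shows "orthonormal n (M t)"
proof (rule orthonormalI_nth)
  show "set (M t) \<subseteq> carrier_vec n" using M_H[OF assms] H_carrier by auto
  fix p q assume "p < length (M t)" "q < length (M t)"
  thus "M t ! p \<bullet>c M t ! q = (if p = q then 1 else 0)"
    using top_vec_inner[OF top_vec_E top_vec_E, of "E k ! p" "E k ! q" "k - t" "k - t"]
      onb_E[of k] orthonormal_nth[of n "E k" p q] assms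
    by (auto simp: M_def onb_def)
qed

lemma coord_mat_M:
  assumes "t \<in> {1..<k}"
  shows "coord_mat A (M t) (M (Suc t)) = 1\<^sub>m (length (E k))"
proof (rule eq_matI)
  fix p q assume "p < dim_row (1\<^sub>m (length (E k)) :: complex mat)" "q < dim_col (1\<^sub>m (length (E k)) :: complex mat)"
  hence pq: "p < length (E k)" "q < length (E k)" by auto
  have "Suc (k - Suc t) = k - t" using assms by auto
  thus "coord_mat A (M t) (M (Suc t)) $$ (p, q) = 1\<^sub>m (length (E k)) $$ (p, q)"
    using top_vec_A_inner[OF top_vec_E top_vec_E, of "E k ! q" "E k ! p" "k - Suc t" "k - t"]
      onb_E[of k] orthonormal_nth[of n "E k" q p] assms pq
    by (auto simp: M_def onb_def)
qed auto

text \<open>The chains of length \<open>k\<close> stay together with \<open>W\<close> because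
  \<open>A\<close> may map \<open>W\<close> onto vectors with components along their tops
  \<open>E k\<close>; these components form \<open>B\<close>.\<close>

definition main :: "complex vec list" where
  "main = concat (map M [1..<Suc k]) @ W"

lemma set_mainE:
  assumes "x \<in> set main"
  obtains e a where "top_vec k e" "e \<in> set (E k)" "a < k" "x = A ^\<^sub>m a *\<^sub>v e" | "x \<in> set W"
proof -
  from assms consider "x \<in> set W" | t where "t \<in> {1..k}" "x \<in> set (M t)"
    by (auto simp: main_def less_Suc_eq_le simp del: upt_Suc)
  thus ?thesis
  proof cases
    case (2 t)
    then obtain e where "e \<in> set (E k)" "x = A ^\<^sub>m (k - t) *\<^sub>v e" by (auto simp: M_def)
    thus ?thesis using that(1)[of e "k - t"] 2(1) top_vec_E by auto
  qed (rule that(2))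
qed

lemma orthonormal_main: "orthonormal n main"
proof -
  have "sorted_wrt (\<lambda>bs cs. \<forall>b \<in> set bs. \<forall>c \<in> set cs. b \<bullet>c c = 0) (map M [1..<Suc k])"
    unfolding sorted_wrt_map
  proof (rule sorted_wrt_mono_rel[OF _ sorted_wrt_upt])
    fix i j assume "i \<in> set [1..<Suc k]" "j \<in> set [1..<Suc k]" "i < j"
    thus "\<forall>b \<in> set (M i). \<forall>c \<in> set (M j). b \<bullet>c c = 0"
      using M_H[of i] M_H[of j] H_orth_H[of _ i _ j] by (auto simp: less_Suc_eq_le simp del: upt_Suc)
  qed
  moreover have "\<forall>bs \<in> set (map M [1..<Suc k]). orthonormal n bs"
    using orthonormal_M by (auto simp: less_Suc_eq_le simp del: upt_Suc)
  ultimately have "orthonormal n (concat (map M [1..<Suc k]))"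
    unfolding orthonormal_concat by blast
  moreover have "b \<bullet>c w = 0" if "b \<in> set (concat (map M [1..<Suc k]))" "w \<in> set W" for b w
  proof -
    from that(1) obtain t where "t \<in> {1..k}" "b \<in> set (M t)"
      by (auto simp: less_Suc_eq_le simp del: upt_Suc)
    thus ?thesis using M_H[of t] H_orth_R[of b t w k] W_R[OF that(2)] by auto
  qed
  ultimately show ?thesis
    unfolding main_def orthonormal_append using onb_W by (auto simp: onb_def simp del: upt_Suc)
qed

lemma coord_mat_main:
  "coord_mat A main main = superdiag_mat (replicate (k - 1) (1\<^sub>m (length (E k))) @ [coord_mat A (E k) W]) (coord_mat A W W)"
proof -
  have "map (\<lambda>i. coord_mat A (M i) (M (Suc i))) [1..<k] = map (\<lambda>i. 1\<^sub>m (length (E k))) [1..<k]"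
    by (intro map_cong refl coord_mat_M) simp
  also have "\<dots> = replicate (k - 1) (1\<^sub>m (length (E k)))" by (simp add: map_replicate_const)
  finally show ?thesis using superdiag_mat_levels[OF M_H] unfolding main_def by (simp add: M_k)
qed

text \<open>Ordered by decreasing length, as are the Jordan blocks in form (c). The length is kept
  beside each top because \<open>chain\<close> depends on it.\<close>

definition tops :: "(nat \<times> complex vec) list" where
  "tops = concat (map (\<lambda>j. map (Pair j) (F j)) (rev [1..<k]))"

lemma topsD:
  assumes "(j, f) \<in> set tops"
  shows "top_vec j f" "f \<bullet>c f = 1" "j < k"
proof -
  have *: "j \<in> {1..<k}" "f \<in> set (F j)" using assms by (auto simp: tops_def)
  thus "top_vec j f" "j < k" by (auto intro: top_vec_F)
  show "f \<bullet>c f = 1" using onb_F[OF *(1)] *(2) by (auto simp: onb_def orthonormal_def)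
qed

lemma tops_orthogonal: "sorted_wrt (\<lambda>(i, f) (j, g). f \<bullet>c g = 0) tops"
  unfolding tops_def sorted_wrt_concat
proof
  show "\<forall>xs \<in> set (map (\<lambda>j. map (Pair j) (F j)) (rev [1..<k])). sorted_wrt (\<lambda>(i, f) (j, g). f \<bullet>c g = 0) xs"
    using onb_F by (auto simp: sorted_wrt_map onb_def orthonormal_append) (auto simp: orthonormal_def)
  show "sorted_wrt (\<lambda>xs ys. \<forall>x \<in> set xs. \<forall>y \<in> set ys. (\<lambda>(i, f) (j, g). f \<bullet>c g = 0) x y)
     (map (\<lambda>j. map (Pair j) (F j)) (rev [1..<k]))"
    unfolding sorted_wrt_map sorted_wrt_rev
  proof (rule sorted_wrt_mono_rel[OF _ sorted_wrt_upt])
    fix i j assume ij: "i \<in> set [1..<k]" "j \<in> set [1..<k]" "i < j"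
    have "set (F t) \<subseteq> H t" if "t \<in> set [1..<k]" for t
      using onb_F[of t] that by (auto simp: onb_def)
    with ij have "g \<bullet>c f = 0" if "f \<in> set (F i)" "g \<in> set (F j)" for f g
      using that H_orth_H[of g j f i] by blast
    thus "\<forall>x \<in> set (map (Pair j) (F j)). \<forall>y \<in> set (map (Pair i) (F i)).
        (\<lambda>(i, f) (j, g). f \<bullet>c g = 0) x y"
      by auto
  qed
qed

definition blocks :: "complex vec list list" where
  "blocks = main # map (\<lambda>(j, f). chain j f) tops"

lemma main_orth_top:
  assumes "top_vec k e" "top_vec j f" "j < k"
  shows "e \<bullet>c f = 0" "f \<bullet>c e = 0"
  using H_orth_H[OF top_vecD(3)[OF assms(1)] top_vecD(3)[OF assms(2)]]
    H_orth_H[OF top_vecD(3)[OF assms(2)] top_vecD(3)[OF assms(1)]] assms(3) by auto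

text \<open>Inner products between chains reduce to those of their tops by
  \<open>top_vec_inner\<close>; against \<open>W\<close> it is enough that chain vectors lie in
  layers below \<open>k\<close>.\<close>

lemma orthonormal_blocks: "orthonormal n (concat blocks)"
  unfolding orthonormal_concat
proof
  show "\<forall>bs \<in> set blocks. orthonormal n bs"
    using orthonormal_main topsD orthonormal_chain by (auto simp: blocks_def)
  have "b \<bullet>c c = 0" if b: "b \<in> set main" and f: "(j, f) \<in> set tops" and c: "c \<in> set (chain j f)" for b c j f
  proof -
    note f' = topsD[OF f]
    obtain a where a: "a < j" "c = A ^\<^sub>m a *\<^sub>v f" using c by (rule set_chainE)
    from b show ?thesis
    proof (cases rule: set_mainE)
      case (1 e a')
      thus ?thesis using top_vec_inner[OF 1(1) f'(1) 1(3) a(1)] main_orth_top[OF 1(1) f'(1,3)] a by simp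
    next
      case 2
      have "c \<in> H (j - a)" using top_vec_pow_H[OF f'(1)] a by auto
      hence "c \<bullet>c b = 0" using H_orth_R[of c "j - a" b k] W_R[OF 2] f'(3) by auto
      thus ?thesis
        using cscalar_prod_eq_0_commute[of c n b] H_carrier[OF \<open>c \<in> H (j - a)\<close>] R_carrier[OF W_R[OF 2]] by simp
    qed
  qed
  moreover have "sorted_wrt (\<lambda>x y. \<forall>b \<in> set (case x of (j, f) \<Rightarrow> chain j f).
      \<forall>c \<in> set (case y of (j, f) \<Rightarrow> chain j f). b \<bullet>c c = 0) tops"
  proof (rule sorted_wrt_mono_rel[OF _ tops_orthogonal])
    fix x y assume x: "x \<in> set tops" and y: "y \<in> set tops" and xy: "(\<lambda>(i, f) (j, g). f \<bullet>c g = 0) x y"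
    obtain i f j g where eq: "x = (i, f)" "y = (j, g)" by fastforce
    show "\<forall>b \<in> set (case x of (j, f) \<Rightarrow> chain j f). \<forall>c \<in> set (case y of (j, f) \<Rightarrow> chain j f). b \<bullet>c c = 0"
      using x y xy topsD(1)[of i f] topsD(1)[of j g] top_vec_inner[of i f j g]
      unfolding eq by (auto elim!: set_chainE)
  qed
  ultimately show "sorted_wrt (\<lambda>bs cs. \<forall>b \<in> set bs. \<forall>c \<in> set cs. b \<bullet>c c = 0) blocks"
    unfolding blocks_def by (auto simp: sorted_wrt_map)
qed

lemma coord_mat_blocks:
  "coord_mat A (concat blocks) (concat blocks) = diag_block_mat (map (\<lambda>bs. coord_mat A bs bs) blocks)"
proof (rule coord_mat_concat_diag)
  have "(A *\<^sub>v c) \<bullet>c b = 0 \<and> (A *\<^sub>v b) \<bullet>c c = 0"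
    if b: "b \<in> set main" and f: "(j, f) \<in> set tops" and c: "c \<in> set (chain j f)" for b c j f
  proof -
    note f' = topsD[OF f]
    obtain a where a: "a < j" "c = A ^\<^sub>m a *\<^sub>v f" using c by (rule set_chainE)
    from b show ?thesis
    proof (cases rule: set_mainE)
      case (1 e a')
      thus ?thesis
        using top_vec_A_inner[OF 1(1) f'(1) 1(3) a(1)] top_vec_A_inner[OF f'(1) 1(1) a(1) 1(3)]
          main_orth_top[OF 1(1) f'(1,3)] a by simp
    next
      case 2
      have cH: "c \<in> H (j - a)" using top_vec_pow_H[OF f'(1)] a by auto
      hence "A *\<^sub>v c \<in> H (j - a - 1)" using A_H[OF cH] a f'(3) by auto
      hence "(A *\<^sub>v c) \<bullet>c b = 0" using H_orth_R[of _ "j - a - 1" b k] W_R[OF 2] f'(3) by auto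
      \<comment> \<open>The image of \<open>b\<close> may leave \<open>R k\<close>, but it stays in
        \<open>R (k - 1)\<close>, and a chain shorter than \<open>k\<close> lies in the kernel
        orthogonal to that.\<close>
      moreover have "A *\<^sub>v b \<in> R (k - 1)" using A_R[of b "k - 1"] W_R[OF 2] k by auto
      moreover have "c \<in> K (k - 1)"
        by (rule subsetD[OF K_mono subsetD[OF H_subset_K cH]]) (use f'(3) in auto)
      ultimately show ?thesis using R_orth_K by blast
    qed
  qed
  moreover have "sorted_wrt (\<lambda>x y. \<forall>b \<in> set (case x of (j, f) \<Rightarrow> chain j f).
      \<forall>c \<in> set (case y of (j, f) \<Rightarrow> chain j f). (A *\<^sub>v c) \<bullet>c b = 0 \<and> (A *\<^sub>v b) \<bullet>c c = 0) tops"
  proof (rule sorted_wrt_mono_rel[OF _ tops_orthogonal])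
    fix x y assume x: "x \<in> set tops" and y: "y \<in> set tops" and xy: "(\<lambda>(i, f) (j, g). f \<bullet>c g = 0) x y"
    obtain i f j g where eq: "x = (i, f)" "y = (j, g)" by fastforce
    have "top_vec i f" "top_vec j g" using x y topsD(1) eq by auto
    moreover have "f \<bullet>c g = 0" using xy eq by simp
    moreover from calculation have "g \<bullet>c f = 0"
      using cscalar_prod_eq_0_commute[of f n g] top_vecD(4) by auto
    ultimately show "\<forall>b \<in> set (case x of (j, f) \<Rightarrow> chain j f). \<forall>c \<in> set (case y of (j, f) \<Rightarrow> chain j f).
        (A *\<^sub>v c) \<bullet>c b = 0 \<and> (A *\<^sub>v b) \<bullet>c c = 0"
      using top_vec_A_inner[of i f j g] top_vec_A_inner[of j g i f]
      unfolding eq by (auto elim!: set_chainE)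
  qed
  ultimately show "sorted_wrt (\<lambda>bs cs. \<forall>b \<in> set bs. \<forall>c \<in> set cs. (A *\<^sub>v c) \<bullet>c b = 0 \<and> (A *\<^sub>v b) \<bullet>c c = 0) blocks"
    unfolding blocks_def by (auto simp: sorted_wrt_map)
qed

lemma sum_block_sizes:
  "k * length (E k) + (\<Sum>j=1..k - 1. (length (E j) - length (E (j + 1))) * j) + length W = n"
proof -
  have "length (E (Suc j)) \<le> length (E j)" if "j \<in> {1..<k}" for j
    using length_F[OF that] by simp
  moreover have "{1..k - 1} = {1..<k}" using k by auto
  ultimately show ?thesis using sum_telescope_mult[of k "\<lambda>j. length (E j)"] length_W by simp
qed

text \<open>Counting replaces a proof that the chains span: by \<open>length_F\<close> the number of
  tops of height \<open>j\<close> is the drop in dimension from layer \<open>j\<close> to layer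
  \<open>j + 1\<close>.\<close>

lemma length_blocks: "length (concat blocks) = n"
proof -
  have "length (concat (map (\<lambda>(j, f). chain j f) tops)) = (\<Sum>(j, f)\<leftarrow>tops. j)"
    by (simp add: length_concat comp_def case_prod_unfold)
  also have "\<dots> = (\<Sum>j\<leftarrow>rev [1..<k]. length (F j) * j)"
    unfolding tops_def
    by (simp add: map_concat comp_def sum_list_concat map_replicate_const sum_list_replicate)
  also have "\<dots> = (\<Sum>j\<in>{1..<k}. length (F j) * j)"
    by (subst sum_list_distinct_conv_sum_set) simp_all
  also have "\<dots> = (\<Sum>j=1..k - 1. (length (E j) - length (E (j + 1))) * j)"
    using length_F k by (intro sum.cong) fastforce+
  finally have 1: "length (concat (map (\<lambda>(j, f). chain j f) tops)) =
    (\<Sum>j=1..k - 1. (length (E j) - length (E (j + 1))) * j)" .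
  have "length main = k * length (E k) + length W"
    by (simp add: main_def length_concat comp_def sum_list_triv del: upt_Suc)
  thus ?thesis using 1 sum_block_sizes by (simp add: blocks_def)
qed

lemma jordan_block_form_E:
  "jordan_block_form A k (\<lambda>j. length (E j)) (length W) (coord_mat A (E k) W) (coord_mat A W W)"
proof -
  have "map (\<lambda>(j, f). coord_mat A (chain j f) (chain j f)) tops = map (\<lambda>(j, f). jordan_block j 0) tops"
    using topsD coord_mat_chain by (intro map_cong refl) auto
  also have "\<dots> = concat (map (\<lambda>j. replicate (length (F j)) (jordan_block j 0)) (rev [1..<k]))"
    unfolding tops_def by (simp add: map_concat comp_def map_replicate_const)
  also have "\<dots> = concat (map (\<lambda>j. replicate (length (E j) - length (E (j + 1))) (jordan_block j 0)) (rev [1..<k]))"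
    using length_F by (intro arg_cong[where f = concat] map_cong refl arg_cong2[where f = replicate]) fastforce
  finally have "map (\<lambda>bs. coord_mat A bs bs) blocks =
    superdiag_mat (replicate (k - 1) (1\<^sub>m (length (E k))) @ [coord_mat A (E k) W]) (coord_mat A W W) #
      concat (map (\<lambda>j. replicate (length (E j) - length (E (j + 1))) (jordan_block j 0)) (rev [1..<k]))"
    by (simp add: blocks_def coord_mat_main case_prod_unfold comp_def)
  moreover have "unitary_similar A (diag_block_mat (map (\<lambda>bs. coord_mat A bs bs) blocks))"
    using unitary_similar_coord_mat[OF A onb_carrierI[OF orthonormal_blocks length_blocks]] coord_mat_blocks by simp
  ultimately show ?thesis
    unfolding jordan_block_form_def
    using kernel_block_sizes_E sum_block_sizes coord_mat_W_isometric A by auto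
qed

end

section \<open>Graded bases\<close>

text \<open>\<open>ls ! i\<close> is the level of coordinate \<open>i\<close>; the loop at level
  \<open>k\<close> leaves room for \<open>C\<close>. For \<open>k > 0\<close> the columns of level 0
  vanish, so orthonormality is asked of the others only. Levels need not be sorted, so a direct sum
  just appends its lists.\<close>

definition graded :: "nat \<Rightarrow> nat list \<Rightarrow> complex mat \<Rightarrow> bool" where
  "graded k ls M \<longleftrightarrow> M \<in> carrier_mat (length ls) (length ls) \<and>
     (\<forall>i < length ls. \<forall>j < length ls. M $$ (i, j) \<noteq> 0 \<longrightarrow>
        Suc (ls ! i) = ls ! j \<or> ls ! i = k \<and> ls ! j = k) \<and>
     (\<forall>i < length ls. \<forall>j < length ls. 0 < ls ! i \<longrightarrow> 0 < ls ! j \<longrightarrow>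
        col M j \<bullet>c col M i = (if i = j then 1 else 0))"

locale graded_basis = square_mat A n for A n +
  fixes k :: nat and bs :: "complex vec list" and ls :: "nat list"
  assumes bs: "onb n (carrier_vec n) bs"
    and graded: "graded k ls (coord_mat A bs bs)"
begin

lemma len: "length bs = n" "length ls = n"
  using onb_carrier_length[OF bs] graded by (auto simp: graded_def)

lemma bs_carrier [simp]: "p < n \<Longrightarrow> bs ! p \<in> carrier_vec n"
  using bs len(1) by (auto simp: onb_def)

lemma orthonormal_bs: "orthonormal n bs"
  using bs by (auto simp: onb_def)

lemma coord_neq_0:
  assumes "p < n" "q < n" "(A *\<^sub>v bs ! q) \<bullet>c bs ! p \<noteq> 0"
  shows "Suc (ls ! p) = ls ! q \<or> ls ! p = k \<and> ls ! q = k"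
  using graded assms len by (auto simp: graded_def)

section \<open>Action of the powers on the levels\<close>

lemma expand:
  assumes "x \<in> carrier_vec n" "y \<in> carrier_vec n"
  shows "x \<bullet>c y = (\<Sum>p<n. (x \<bullet>c bs ! p) * (bs ! p \<bullet>c y))"
  using parseval[OF bs vsubspace_carrier assms]
  by (simp add: sum_list_sum_nth len lessThan_atLeast0)

lemma A_expand:
  assumes "x \<in> carrier_vec n" "y \<in> carrier_vec n"
  shows "(A *\<^sub>v x) \<bullet>c y = (\<Sum>p<n. (x \<bullet>c bs ! p) * ((A *\<^sub>v bs ! p) \<bullet>c y))"
proof -
  have "set bs \<subseteq> carrier_vec n" using orthonormal_bs by (simp add: orthonormal_def)
  from mult_mat_proj_cscalar_prod[OF this assms(2) A, of x] show ?thesis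
    using proj_eq_self[OF bs vsubspace_carrier assms(1)]
    by (simp add: sum_list_sum_nth len lessThan_atLeast0)
qed

lemma eq_0I:
  assumes "x \<in> carrier_vec n" "\<And>p. p < n \<Longrightarrow> x \<bullet>c bs ! p = 0"
  shows "x = 0\<^sub>v n"
proof -
  have "x \<bullet>c b = 0" if "b \<in> set bs" for b
    using that assms(2) len(1) by (auto simp: in_set_conv_nth)
  thus ?thesis using bs assms(1) by (auto simp: onb_def)
qed

lemma A_isometric_coord:
  assumes "p < n" "q < n" "0 < ls ! p" "0 < ls ! q"
  shows "(A *\<^sub>v bs ! q) \<bullet>c (A *\<^sub>v bs ! p) = (if p = q then 1 else 0)"
proof -
  let ?M = "coord_mat A bs bs"
  have "(A *\<^sub>v bs ! q) \<bullet>c (A *\<^sub>v bs ! p) = (\<Sum>i<n. ((A *\<^sub>v bs ! q) \<bullet>c bs ! i) * (bs ! i \<bullet>c (A *\<^sub>v bs ! p)))"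
    using assms by (intro expand) auto
  also have "\<dots> = (\<Sum>i<n. ((A *\<^sub>v bs ! q) \<bullet>c bs ! i) * cnj ((A *\<^sub>v bs ! p) \<bullet>c bs ! i))"
    using assms cscalar_prod_commute[of _ n "A *\<^sub>v bs ! p"]
    by (intro sum.cong refl arg_cong2[where f = "(*)"]) auto
  also have "\<dots> = col ?M q \<bullet>c col ?M p"
  proof -
    have "col ?M p \<in> carrier_vec n" using len(1) by (simp add: carrier_vecI)
    from cscalar_prod_sum[OF this, of "col ?M q"] show ?thesis using assms len(1) by simp
  qed
  finally show ?thesis using graded assms len by (auto simp: graded_def)
qed

text \<open>For \<open>j \<le> k\<close>, \<open>U j\<close> will turn out to be
  \<open>ker A^j\<close> and \<open>V j\<close> its orthogonal complement. Both are given by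
  vanishing coordinates, so that \<open>A\<close> can be followed entry by entry.\<close>

definition V :: "nat \<Rightarrow> complex vec set" where
  "V j = {x \<in> carrier_vec n. \<forall>p < n. ls ! p < j \<longrightarrow> x \<bullet>c bs ! p = 0}"

definition U :: "nat \<Rightarrow> complex vec set" where
  "U j = {x \<in> carrier_vec n. \<forall>p < n. j \<le> ls ! p \<longrightarrow> x \<bullet>c bs ! p = 0}"

lemma U_vsubspace: "vsubspace n (U j)"
proof -
  have "U j = orth_diff (carrier_vec n) {bs ! p |p. p < n \<and> j \<le> ls ! p}"
    by (auto simp: U_def orth_diff_def)
  moreover have "vsubspace n \<dots>"
    by (intro vsubspace_orth_diff vsubspace_carrier) auto
  ultimately show ?thesis by simp
qed

lemma A_V:
  assumes x: "x \<in> V (Suc j)" and j: "j \<le> k"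
  shows "A *\<^sub>v x \<in> V j"
proof -
  have xc: "x \<in> carrier_vec n" using x by (simp add: V_def)
  have "(A *\<^sub>v x) \<bullet>c bs ! p = 0" if p: "p < n" "ls ! p < j" for p
  proof -
    \<comment> \<open>A nonzero entry needs \<open>ls ! q = Suc (ls ! p) \<le> j\<close>, where
      \<open>x\<close> has no coordinate; the loop at level \<open>k\<close> is excluded by
      \<open>ls ! p < j \<le> k\<close>.\<close>
    have "(x \<bullet>c bs ! q) * ((A *\<^sub>v bs ! q) \<bullet>c bs ! p) = 0" if "q < n" for q
      using coord_neq_0[OF p(1) that] x that p j by (auto simp: V_def)
    thus ?thesis unfolding A_expand[OF xc bs_carrier[OF p(1)]] by (intro sum.neutral) auto
  qed
  thus ?thesis using xc by (simp add: V_def)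
qed

lemma A_U:
  assumes x: "x \<in> U (Suc j)" and j: "j < k"
  shows "A *\<^sub>v x \<in> U j"
proof -
  have xc: "x \<in> carrier_vec n" using x by (simp add: U_def)
  have "(A *\<^sub>v x) \<bullet>c bs ! p = 0" if p: "p < n" "j \<le> ls ! p" for p
  proof -
    \<comment> \<open>The loop at level \<open>k\<close> does no harm: \<open>Suc j \<le> k\<close>,
      so \<open>x\<close> has no coordinate there.\<close>
    have "(x \<bullet>c bs ! q) * ((A *\<^sub>v bs ! q) \<bullet>c bs ! p) = 0" if "q < n" for q
      using coord_neq_0[OF p(1) that] x that p j by (auto simp: U_def)
    thus ?thesis unfolding A_expand[OF xc bs_carrier[OF p(1)]] by (intro sum.neutral) auto
  qed
  thus ?thesis using xc by (simp add: U_def)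
qed

text \<open>\<open>x\<close> has no coordinate at level 0, and the images of the remaining basis
  vectors are orthonormal.\<close>

lemma A_isometry:
  assumes x: "x \<in> V 1"
  shows "(A *\<^sub>v x) \<bullet>c (A *\<^sub>v x) = x \<bullet>c x"
proof -
  have xc: "x \<in> carrier_vec n" using x by (simp add: V_def)
  have coord: "(A *\<^sub>v bs ! p) \<bullet>c (A *\<^sub>v x) = bs ! p \<bullet>c x" if p: "p < n" "0 < ls ! p" for p
  proof -
    have "(A *\<^sub>v x) \<bullet>c (A *\<^sub>v bs ! p) = (\<Sum>q<n. (x \<bullet>c bs ! q) * ((A *\<^sub>v bs ! q) \<bullet>c (A *\<^sub>v bs ! p)))"
      using p by (intro A_expand xc) auto
    also have "\<dots> = (\<Sum>q\<in>{p}. (x \<bullet>c bs ! q) * ((A *\<^sub>v bs ! q) \<bullet>c (A *\<^sub>v bs ! p)))"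
      using p x A_isometric_coord[OF p(1) _ p(2)] by (intro sum.mono_neutral_right) (auto simp: V_def)
    also have "\<dots> = x \<bullet>c bs ! p" using A_isometric_coord[OF p(1) p(1) p(2) p(2)] by simp
    finally show ?thesis
      using cscalar_prod_commute[of "A *\<^sub>v bs ! p" n "A *\<^sub>v x"] cscalar_prod_commute[of "bs ! p" n x]
        p(1) xc by simp
  qed
  have "(A *\<^sub>v x) \<bullet>c (A *\<^sub>v x) = (\<Sum>p<n. (x \<bullet>c bs ! p) * ((A *\<^sub>v bs ! p) \<bullet>c (A *\<^sub>v x)))"
    using xc by (intro A_expand) auto
  also have "\<dots> = (\<Sum>p<n. (x \<bullet>c bs ! p) * (bs ! p \<bullet>c x))"
  proof (intro sum.cong refl)
    fix p assume "p \<in> {..<n}"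
    thus "(x \<bullet>c bs ! p) * ((A *\<^sub>v bs ! p) \<bullet>c (A *\<^sub>v x)) = (x \<bullet>c bs ! p) * (bs ! p \<bullet>c x)"
      using coord[of p] x by (cases "ls ! p = 0") (auto simp: V_def)
  qed
  also have "\<dots> = x \<bullet>c x" by (rule expand[OF xc xc, symmetric])
  finally show ?thesis .
qed

text \<open>Each application of \<open>A\<close> lowers the guaranteed level by one, so before each
  of the \<open>j\<close> steps the vector is still in \<open>V 1\<close>, where \<open>A\<close> is
  isometric.\<close>

lemma pow_isometry:
  assumes "x \<in> V j" "j \<le> k"
  shows "(A ^\<^sub>m j *\<^sub>v x) \<bullet>c (A ^\<^sub>m j *\<^sub>v x) = x \<bullet>c x"
  using assms
proof (induction j arbitrary: x)
  case 0
  thus ?case using A by (simp add: V_def)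
next
  case (Suc j)
  have "x \<in> carrier_vec n" "x \<in> V 1" using Suc.prems by (auto simp: V_def)
  moreover have "A *\<^sub>v x \<in> V j" using A_V Suc.prems by simp
  ultimately show ?case using Suc A_isometry by (simp add: pow_Suc_vec del: pow_mat.simps)
qed

lemma pow_U:
  assumes "x \<in> U j" "j \<le> k"
  shows "A ^\<^sub>m j *\<^sub>v x = 0\<^sub>v n"
  using assms
proof (induction j arbitrary: x)
  case 0
  hence "x = 0\<^sub>v n" by (intro eq_0I) (auto simp: U_def)
  thus ?case using A by simp
next
  case (Suc j)
  have "x \<in> carrier_vec n" using Suc.prems by (auto simp: U_def)
  thus ?case using Suc A_U[of x j] by (simp add: pow_Suc_vec del: pow_mat.simps)
qed

definition low :: "nat \<Rightarrow> complex vec list" where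
  "low j = map (\<lambda>p. bs ! p) (filter (\<lambda>p. ls ! p < j) [0..<n])"

lemma orthonormal_low: "orthonormal n (low j)"
proof -
  have "map ((!) bs) [0..<n] = bs" using len(1) by (metis map_nth)
  hence "sorted_wrt (\<lambda>u v. u \<bullet>c v = 0) (map ((!) bs) [0..<n])"
    using orthonormal_bs by (simp add: orthonormal_def)
  hence "sorted_wrt (\<lambda>u v. u \<bullet>c v = 0) (low j)"
    unfolding low_def sorted_wrt_map by (rule sorted_wrt_filter)
  moreover have "bs ! p \<bullet>c bs ! p = 1" if "p < n" for p
    using orthonormal_nth[OF orthonormal_bs, of p p] that len by simp
  ultimately show ?thesis by (auto simp: orthonormal_def low_def)
qed

lemma low_U: "set (low j) \<subseteq> U j"
proof -
  have "bs ! p \<bullet>c bs ! q = 0" if "p < n" "q < n" "ls ! p < j" "j \<le> ls ! q" for p q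
    using orthonormal_nth[OF orthonormal_bs, of p q] that len by auto
  thus ?thesis by (auto simp: low_def U_def)
qed

text \<open>Let \<open>y\<close> be the projection of a kernel vector \<open>x\<close> to the levels
  below \<open>j\<close>. \<open>A^j\<close> kills both, yet preserves the norm of
  \<open>x - y\<close>, which is therefore zero.\<close>

lemma kernel_eq_U:
  assumes j: "j \<le> k"
  shows "mat_kernel (A ^\<^sub>m j) = U j"
proof
  show "U j \<subseteq> mat_kernel (A ^\<^sub>m j)"
    using pow_U[OF _ j] unfolding mat_kernel[OF pow] by (auto simp: U_def)
  show "mat_kernel (A ^\<^sub>m j) \<subseteq> U j"
  proof
    fix x assume "x \<in> mat_kernel (A ^\<^sub>m j)"
    hence xc: "x \<in> carrier_vec n" and x0: "A ^\<^sub>m j *\<^sub>v x = 0\<^sub>v n"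
      unfolding mat_kernel[OF pow] by auto
    define y where "y = proj n (low j) x"
    have y: "y \<in> U j" unfolding y_def by (rule proj_mem[OF U_vsubspace low_U])
    hence yc: "y \<in> carrier_vec n" by (simp add: U_def)
    have "(x - y) \<bullet>c bs ! p = 0" if "p < n" "ls ! p < j" for p
      unfolding y_def using that by (intro diff_proj_orthogonal[OF orthonormal_low _ xc]) (auto simp: low_def)
    hence z: "x - y \<in> V j" using xc yc by (simp add: V_def)
    have "A ^\<^sub>m j *\<^sub>v (x - y) = A ^\<^sub>m j *\<^sub>v x - A ^\<^sub>m j *\<^sub>v y"
      by (rule mult_minus_distrib_mat_vec[OF pow xc yc])
    also have "\<dots> = 0\<^sub>v n" using x0 pow_U[OF y j] by simp
    finally have "(x - y) \<bullet>c (x - y) = 0" using pow_isometry[OF z j] by simp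
    moreover have "x - y \<in> carrier_vec n" using xc yc by simp
    ultimately have "x - y = 0\<^sub>v n" by (metis conjugate_square_eq_0_vec)
    thus "x \<in> U j" using vec_minus_eq_0D[OF xc yc] y by simp
  qed
qed

lemma kernel_dim_pow:
  assumes "j \<le> k"
  shows "kernel_dim (A ^\<^sub>m j) = length (filter (\<lambda>l. l < j) ls)"
proof -
  have "x = 0\<^sub>v n" if "x \<in> U j" "\<forall>b \<in> set (low j). x \<bullet>c b = 0" for x
  proof (rule eq_0I)
    show "x \<in> carrier_vec n" using that(1) by (simp add: U_def)
    fix p assume "p < n"
    thus "x \<bullet>c bs ! p = 0"
      using that by (cases "ls ! p < j") (auto simp: U_def low_def)
  qed
  hence "onb n (mat_kernel (A ^\<^sub>m j)) (low j)"
    unfolding kernel_eq_U[OF assms] onb_def using orthonormal_low low_U by blast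
  hence "kernel_dim (A ^\<^sub>m j) = length (low j)" by (rule kernel_dim_eq_length_onb[OF pow])
  also have "\<dots> = length (filter (\<lambda>l. l < j) (map ((!) ls) [0..<n]))"
    by (simp add: low_def filter_map comp_def)
  also have "map ((!) ls) [0..<n] = ls" using len(2) by (metis map_nth)
  finally show ?thesis .
qed

lemma partial_isometry_pow:
  assumes "j \<le> k"
  shows "partial_isometry (A ^\<^sub>m j)"
  unfolding partial_isometry_def
proof
  fix x assume x: "x \<in> ker_perp (A ^\<^sub>m j)"
  hence xc: "x \<in> carrier_vec n" using carrier_matD[OF pow[of j]] by (simp add: ker_perp_def)
  have "x \<bullet>c y = 0" if "y \<in> U j" for y
    using x that kernel_eq_U[OF assms] by (auto simp: ker_perp_def)
  moreover have "bs ! p \<in> U j" if "p < n" "ls ! p < j" for p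
    using low_U that by (auto simp: low_def)
  ultimately have "x \<in> V j" using xc by (simp add: V_def)
  thus "vec_l2norm (A ^\<^sub>m j *\<^sub>v x) = vec_l2norm x"
    unfolding vec_l2norm_eq_iff using pow_isometry assms by blast
qed

end

section \<open>The block forms are graded\<close>

lemma sum_lessThan_add:
  fixes f :: "nat \<Rightarrow> 'a::comm_monoid_add"
  shows "(\<Sum>p<r + s. f p) = (\<Sum>p<r. f p) + (\<Sum>p<s. f (r + p))"
  by (induction s) (simp_all add: add.assoc)

lemma col_cscalar_prod:
  fixes M :: "complex mat"
  assumes "M \<in> carrier_mat r c" "i < c" "j < c"
  shows "col M j \<bullet>c col M i = (\<Sum>p<r. M $$ (p, j) * cnj (M $$ (p, i)))"
  using assms by (auto simp: scalar_prod_def lessThan_atLeast0 intro!: sum.cong)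

text \<open>Bordering by a zero block raises the old levels by one and gives level 0 to the new
  coordinates. Old columns of level 0 become positive, so every column of \<open>Q\<close> above
  \<open>M\<close> has to take part in the orthonormality.\<close>

lemma graded_four_block_superdiag:
  assumes Q: "Q \<in> carrier_mat r (length ls)" and M: "M \<in> carrier_mat (length ls) (length ls)"
    and M0: "\<And>i j. \<lbrakk>i < length ls; j < length ls; M $$ (i, j) \<noteq> 0\<rbrakk> \<Longrightarrow>
               Suc (ls ! i) = ls ! j \<or> ls ! i = k \<and> ls ! j = k"
    and Q0: "\<And>i j. \<lbrakk>i < r; j < length ls; Q $$ (i, j) \<noteq> 0\<rbrakk> \<Longrightarrow> ls ! j = 0"
    and iso: "\<And>i j. \<lbrakk>i < length ls; j < length ls\<rbrakk> \<Longrightarrow>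
               col Q j \<bullet>c col Q i + col M j \<bullet>c col M i = (if i = j then 1 else 0)"
  shows "graded (Suc k) (replicate r 0 @ map Suc ls)
    (four_block_mat (0\<^sub>m r r) Q (0\<^sub>m (length ls) r) M)"
proof -
  let ?s = "length ls"
  let ?N = "four_block_mat (0\<^sub>m r r) Q (0\<^sub>m ?s r) M"
  let ?l = "replicate r 0 @ map Suc ls"
  have N: "?N \<in> carrier_mat (r + ?s) (r + ?s)" using M by auto
  have l: "?l ! i = (if i < r then 0 else Suc (ls ! (i - r)))" if "i < r + ?s" for i
    using that by (simp add: nth_append)
  have idx: "?N $$ (i, j) = (if j < r then 0 else if i < r then Q $$ (i, j - r) else M $$ (i - r, j - r))"
    if "i < r + ?s" "j < r + ?s" for i j
    using that Q M by auto
  have "Suc (?l ! i) = ?l ! j \<or> ?l ! i = Suc k \<and> ?l ! j = Suc k"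
    if "i < r + ?s" "j < r + ?s" "?N $$ (i, j) \<noteq> 0" for i j
  proof -
    have j: "\<not> j < r" using that idx[of i j] by auto
    show ?thesis
    proof (cases "i < r")
      case True
      thus ?thesis using Q0[of i "j - r"] that(3) j that(1,2) by (simp add: idx l)
    next
      case False
      thus ?thesis using M0[of "i - r" "j - r"] that(3) j that(1,2) by (simp add: idx l)
    qed
  qed
  moreover have "col ?N j \<bullet>c col ?N i = (if i = j then 1 else 0)"
    if "i < r + ?s" "j < r + ?s" "0 < ?l ! i" "0 < ?l ! j" for i j
  proof -
    have ij: "\<not> i < r" "\<not> j < r" using that by (auto simp: l split: if_splits)
    hence "col ?N j \<bullet>c col ?N i = col Q (j - r) \<bullet>c col Q (i - r) + col M (j - r) \<bullet>c col M (i - r)"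
      using that(1,2)
      by (simp add: col_cscalar_prod[OF N] col_cscalar_prod[OF Q] col_cscalar_prod[OF M]
          sum_lessThan_add idx del: index_mat_four_block)
    also have "\<dots> = (if i = j then 1 else 0)"
      using iso[of "i - r" "j - r"] that(1,2) ij by auto
    finally show ?thesis .
  qed
  ultimately show ?thesis unfolding graded_def using N by simp
qed

lemma mat_adjoint_mult_self_index:
  assumes "X \<in> carrier_mat r c" "i < c" "j < c"
  shows "col X j \<bullet>c col X i = (mat_adjoint X * X) $$ (i, j)"
  using mat_adjoint_mult_index[OF assms(1,1,2,3)] by simp

text \<open>The recursion starts from \<open>C\<close> with \<open>k = 0\<close> and all levels 0:
  the loop at level 0 permits every entry of \<open>C\<close>.\<close>

lemma graded_superdiag_base:
  assumes B: "B \<in> carrier_mat r m" and C: "C \<in> carrier_mat m m"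
    and iso: "mat_adjoint B * B + mat_adjoint C * C = 1\<^sub>m m"
  shows "graded 1 (replicate r 0 @ map Suc (replicate m 0)) (superdiag_mat [B] C)"
proof -
  have "col B j \<bullet>c col B i + col C j \<bullet>c col C i = (if i = j then 1 else 0)" if "i < m" "j < m" for i j
  proof -
    have "col B j \<bullet>c col B i + col C j \<bullet>c col C i = (mat_adjoint B * B + mat_adjoint C * C) $$ (i, j)"
      using that B C mat_adjoint_carrier[OF B] mat_adjoint_carrier[OF C]
      by (simp add: mat_adjoint_mult_self_index[OF B] mat_adjoint_mult_self_index[OF C] del: index_mult_mat(1))
    thus ?thesis unfolding iso using that by simp
  qed
  thus ?thesis
    unfolding superdiag_mat_single[OF B C]
    using graded_four_block_superdiag[of B r "replicate m 0" C 0] B C by simp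
qed

text \<open>In the first \<open>c\<close> columns, those of level 0, \<open>M\<close> vanishes and
  \<open>X\<close> is isometric; in the others the padding vanishes and \<open>M\<close> is
  isometric. Hence the two Gram matrices add up to the identity.\<close>

lemma graded_superdiag_step:
  assumes M: "graded k ls M" and k: "0 < k"
    and ls: "\<And>i. i < length ls \<Longrightarrow> ls ! i = 0 \<longleftrightarrow> i < c" and c: "c \<le> length ls"
    and X: "X \<in> carrier_mat r c" and iso: "mat_adjoint X * X = 1\<^sub>m c"
  shows "graded (Suc k) (replicate r 0 @ map Suc ls)
    (four_block_mat (0\<^sub>m r r) (pad_cols (length ls) X) (0\<^sub>m (length ls) r) M)"
proof (rule graded_four_block_superdiag)
  let ?Q = "pad_cols (length ls) X"
  show Q: "?Q \<in> carrier_mat r (length ls)" using X by (simp add: pad_cols_def)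
  show M': "M \<in> carrier_mat (length ls) (length ls)" using M by (simp add: graded_def)
  show M0: "Suc (ls ! i) = ls ! j \<or> ls ! i = k \<and> ls ! j = k"
    if "i < length ls" "j < length ls" "M $$ (i, j) \<noteq> 0" for i j
    using M that by (auto simp: graded_def)
  show "ls ! j = 0" if "i < r" "j < length ls" "?Q $$ (i, j) \<noteq> 0" for i j
    using that X ls by (auto simp: pad_cols_def split: if_splits)
  fix i j assume ij: "i < length ls" "j < length ls"
  have colQ: "col ?Q j \<bullet>c col ?Q i = (if i < c \<and> j < c \<and> i = j then 1 else 0)"
  proof (cases "i < c \<and> j < c")
    case True
    have "col ?Q j \<bullet>c col ?Q i = col X j \<bullet>c col X i"
      using True ij X unfolding col_cscalar_prod[OF Q ij] 
      by (subst col_cscalar_prod[OF X]) (auto simp: pad_cols_def)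
    thus ?thesis using True iso mat_adjoint_mult_self_index[OF X, of i j] by auto
  next
    case False
    thus ?thesis using ij X unfolding col_cscalar_prod[OF Q ij]
      by (auto simp: pad_cols_def intro!: sum.neutral)
  qed
  have colM: "col M j \<bullet>c col M i = (if \<not> i < c \<and> \<not> j < c \<and> i = j then 1 else 0)"
  proof (cases "i < c \<or> j < c")
    case True
    hence "ls ! i = 0 \<or> ls ! j = 0" using ls ij by auto
    moreover have "M $$ (p, q) = 0" if "p < length ls" "q < length ls" "ls ! q = 0" for p q
      using M0[OF that(1,2)] that(3) k by (intro ccontr[of "M $$ (p, q) = 0"]) auto
    ultimately have "M $$ (p, j) * cnj (M $$ (p, i)) = 0" if "p < length ls" for p
      using that ij by auto
    thus ?thesis using True unfolding col_cscalar_prod[OF M' ij] by (auto intro!: sum.neutral)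
  next
    case False
    hence "0 < ls ! i" "0 < ls ! j" using ls ij by auto
    thus ?thesis using M ij False by (auto simp: graded_def)
  qed
  show "col ?Q j \<bullet>c col ?Q i + col M j \<bullet>c col M i = (if i = j then 1 else 0)"
    unfolding colQ colM by auto
qed

text \<open>Levels of the blocks from \<open>j\<close> on, shifted so that block \<open>j\<close>
  has level 0. At \<open>j = 1\<close>, block \<open>t\<close> has level \<open>t - 1\<close> and
  the final summand has level \<open>k\<close>.\<close>

definition block_levels :: "(nat \<Rightarrow> nat) \<Rightarrow> nat \<Rightarrow> nat \<Rightarrow> nat \<Rightarrow> nat list" where
  "block_levels d k m j = concat (map (\<lambda>t. replicate (d t) (t - j)) [j..<Suc k]) @ replicate m (Suc k - j)"

lemma block_levels_Suc:
  assumes "j \<le> k"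
  shows "block_levels d k m j = replicate (d j) 0 @ map Suc (block_levels d k m (Suc j))"
proof -
  have "concat (map (\<lambda>t. replicate (d t) (t - j)) [Suc j..<Suc k]) =
    concat (map (\<lambda>t. replicate (d t) (Suc (t - Suc j))) [Suc j..<Suc k])"
  proof (intro arg_cong[where f = concat] map_cong refl)
    fix t assume "t \<in> set [Suc j..<Suc k]"
    hence "t - j = Suc (t - Suc j)" by auto
    thus "replicate (d t) (t - j) = replicate (d t) (Suc (t - Suc j))" by simp
  qed
  thus ?thesis
    using assms unfolding block_levels_def
    by (simp add: upt_conv_Cons[of j "Suc k"] map_concat comp_def Suc_diff_le del: upt_Suc)
qed

lemma graded_superdiag_mat:
  assumes As: "\<And>j. j \<in> {1..<k} \<Longrightarrow> As j \<in> carrier_mat (d j) (d (Suc j)) \<and> mat_adjoint (As j) * As j = 1\<^sub>m (d (Suc j))"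
    and B: "B \<in> carrier_mat (d k) m" and C: "C \<in> carrier_mat m m"
    and iso: "mat_adjoint B * B + mat_adjoint C * C = 1\<^sub>m m"
    and j: "1 \<le> j" "j \<le> k"
  shows "graded (Suc k - j) (block_levels d k m j) (superdiag_mat (map As [j..<k] @ [B]) C)"
  using j(2,1)
proof (induction rule: inc_induct)
  case base
  have "block_levels d k m k = replicate (d k) 0 @ map Suc (replicate m 0)"
    by (simp add: block_levels_Suc) (simp add: block_levels_def)
  thus ?case using graded_superdiag_base[OF B C iso] by simp
next
  case (step j)
  let ?M = "superdiag_mat (map As [Suc j..<k] @ [B]) C"
  let ?L = "block_levels d k m (Suc j)"
  have j: "j \<in> {1..<k}" using step by simp
  have IH: "graded (Suc k - Suc j) ?L ?M" using step by simp
  hence M: "?M \<in> carrier_mat (length ?L) (length ?L)" by (simp add: graded_def)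
  have L: "?L = replicate (d (Suc j)) 0 @ map Suc (block_levels d k m (Suc (Suc j)))"
    using j by (intro block_levels_Suc) auto
  have "?L ! i = 0 \<longleftrightarrow> i < d (Suc j)" if "i < length ?L" for i
    using that unfolding L by (auto simp: nth_append)
  moreover have "d (Suc j) \<le> length ?L" unfolding L by simp
  ultimately have "graded (Suc (Suc k - Suc j)) (replicate (d j) 0 @ map Suc ?L)
    (four_block_mat (0\<^sub>m (d j) (d j)) (pad_cols (length ?L) (As j)) (0\<^sub>m (length ?L) (d j)) ?M)"
    using As[OF j] j by (intro graded_superdiag_step[OF IH]) auto
  moreover have "Suc (Suc k - Suc j) = Suc k - j" using j by auto
  moreover have "superdiag_mat (map As [j..<k] @ [B]) C =
    four_block_mat (0\<^sub>m (d j) (d j)) (pad_cols (length ?L) (As j)) (0\<^sub>m (length ?L) (d j)) ?M"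
  proof -
    have "dim_row (As j) = d j" "dim_col (As j) = d (Suc j)" using As[OF j] by auto
    thus ?thesis using j M by (simp add: upt_conv_Cons[of j k] Let_def)
  qed
  ultimately show ?case using j by (simp add: block_levels_Suc)
qed

lemma length_filter_block_levels:
  assumes "j \<le> k"
  shows "length (filter (\<lambda>l. l < j) (block_levels d k m 1)) = (\<Sum>t=1..j. d t)"
proof -
  have "length (filter (\<lambda>l. l < j) (block_levels d k m 1)) = (\<Sum>t\<leftarrow>[1..<Suc k]. if t - 1 < j then d t else 0)"
    using assms
    by (simp add: block_levels_def filter_concat length_concat comp_def filter_replicate
        if_distrib[of length] cong: if_cong del: upt_Suc)
  also have "\<dots> = (\<Sum>t\<in>{1..k}. if t - 1 < j then d t else 0)"
    by (subst sum_list_distinct_conv_sum_set) (simp_all add: atLeastLessThanSuc_atLeastAtMost del: upt_Suc)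
  also have "\<dots> = (\<Sum>t\<in>{1..j}. if t - 1 < j then d t else 0)"
    using assms by (intro sum.mono_neutral_right) auto
  also have "\<dots> = (\<Sum>t=1..j. d t)" by (intro sum.cong) auto
  finally show ?thesis .
qed

lemma length_block_levels: "length (block_levels d k m 1) = (\<Sum>t=1..k. d t) + m"
proof -
  have "length (block_levels d k m 1) = (\<Sum>t\<leftarrow>[1..<Suc k]. d t) + m"
    by (simp add: block_levels_def length_concat comp_def del: upt_Suc)
  also have "(\<Sum>t\<leftarrow>[1..<Suc k]. d t) = (\<Sum>t=1..k. d t)"
    by (subst sum_list_distinct_conv_sum_set) (simp_all add: atLeastLessThanSuc_atLeastAtMost del: upt_Suc)
  finally show ?thesis .
qed

text \<open>The levels descend along the block without using the loop, so \<open>k\<close> is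
  arbitrary.\<close>

lemma graded_jordan_block: "graded k [0..<j] (jordan_block j 0)"
proof -
  let ?J = "jordan_block j (0 :: complex)"
  have J: "?J \<in> carrier_mat j j" by simp
  have "col ?J q \<bullet>c col ?J p = (if p = q then 1 else 0)" if "p < j" "q < j" "0 < p" "0 < q" for p q
  proof -
    have "col ?J q \<bullet>c col ?J p = (\<Sum>i<j. ?J $$ (i, q) * cnj (?J $$ (i, p)))"
      by (rule col_cscalar_prod[OF J that(1,2)])
    also have "\<dots> = (\<Sum>i\<in>{p - 1}. ?J $$ (i, q) * cnj (?J $$ (i, p)))"
      using that by (intro sum.mono_neutral_right) (auto simp: jordan_block_def)
    also have "\<dots> = (if p = q then 1 else 0)" using that by (auto simp: jordan_block_def)
    finally show ?thesis .
  qed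
  thus ?thesis unfolding graded_def by (auto simp: jordan_block_def)
qed

lemma graded_four_block_diag:
  assumes M: "graded k ls M" and N: "graded k ls' N"
  shows "graded k (ls @ ls') (four_block_mat M (0\<^sub>m (dim_row M) (dim_col N)) (0\<^sub>m (dim_row N) (dim_col M)) N)"
proof -
  let ?r = "length ls" and ?s = "length ls'"
  let ?F = "four_block_mat M (0\<^sub>m (dim_row M) (dim_col N)) (0\<^sub>m (dim_row N) (dim_col M)) N"
  have M': "M \<in> carrier_mat ?r ?r" and N': "N \<in> carrier_mat ?s ?s"
    using M N by (auto simp: graded_def)
  hence F: "?F \<in> carrier_mat (?r + ?s) (?r + ?s)" by auto
  have idx: "?F $$ (i, j) = (if i < ?r \<and> j < ?r then M $$ (i, j)
      else if \<not> i < ?r \<and> \<not> j < ?r then N $$ (i - ?r, j - ?r) else 0)"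
    if "i < ?r + ?s" "j < ?r + ?s" for i j
    using that M' N' by auto
  have "Suc ((ls @ ls') ! i) = (ls @ ls') ! j \<or> (ls @ ls') ! i = k \<and> (ls @ ls') ! j = k"
    if "i < ?r + ?s" "j < ?r + ?s" "?F $$ (i, j) \<noteq> 0" for i j
  proof (cases "i < ?r")
    case True
    hence "j < ?r" "M $$ (i, j) \<noteq> 0" using that idx[OF that(1,2)] by (auto split: if_splits)
    thus ?thesis using M True by (auto simp: graded_def nth_append)
  next
    case False
    hence "\<not> j < ?r" "N $$ (i - ?r, j - ?r) \<noteq> 0" using that idx[OF that(1,2)] by (auto split: if_splits)
    thus ?thesis using N False that(1,2) by (auto simp: graded_def nth_append)
  qed
  moreover have "col ?F j \<bullet>c col ?F i = (if i = j then 1 else 0)"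
    if ij: "i < ?r + ?s" "j < ?r + ?s" and pos: "0 < (ls @ ls') ! i" "0 < (ls @ ls') ! j" for i j
  proof -
    have eq: "col ?F j \<bullet>c col ?F i = (\<Sum>p<?r. ?F $$ (p, j) * cnj (?F $$ (p, i)))
       + (\<Sum>p<?s. ?F $$ (?r + p, j) * cnj (?F $$ (?r + p, i)))"
      unfolding col_cscalar_prod[OF F ij] sum_lessThan_add ..
    consider "i < ?r" "j < ?r" | "\<not> i < ?r" "\<not> j < ?r" | "(i < ?r) \<noteq> (j < ?r)" by blast
    thus ?thesis
    proof cases
      case 1
      hence "col ?F j \<bullet>c col ?F i = col M j \<bullet>c col M i"
        unfolding eq col_cscalar_prod[OF M' 1] by (simp add: idx del: index_mat_four_block)
      thus ?thesis using M 1 pos by (simp add: graded_def nth_append)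
    next
      case 2
      hence ij': "i - ?r < ?s" "j - ?r < ?s" using ij by auto
      hence "col ?F j \<bullet>c col ?F i = col N (j - ?r) \<bullet>c col N (i - ?r)"
        unfolding eq col_cscalar_prod[OF N' ij'] using 2 ij by (simp add: idx del: index_mat_four_block)
      also have "\<dots> = (if i - ?r = j - ?r then 1 else 0)"
        using N 2 pos ij' by (simp add: graded_def nth_append)
      finally show ?thesis using 2 by auto
    next
      case 3
      thus ?thesis unfolding eq using ij by (auto simp: idx simp del: index_mat_four_block)
    qed
  qed
  ultimately show ?thesis unfolding graded_def using F by simp
qed

text \<open>The existence of levels is enough here: form (c) states its block sizes itself, so only
  the partial isometries are derived from its levels.\<close>

lemma graded_diag_block_mat:
  assumes "\<And>M. M \<in> set Ms \<Longrightarrow> \<exists>ls. graded k ls M"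
  shows "\<exists>ls. graded k ls (diag_block_mat Ms)"
  using assms
proof (induction Ms)
  case Nil
  have "graded k [] (diag_block_mat [])" by (simp add: graded_def)
  thus ?case ..
next
  case (Cons M Ms)
  obtain ls where "graded k ls M" using Cons.prems[of M] by auto
  moreover obtain ls' where "graded k ls' (diag_block_mat Ms)" using Cons by auto
  ultimately show ?case using graded_four_block_diag by (fastforce simp: Let_def)
qed

section \<open>From the block forms back to the powers of \<open>A\<close>\<close>

lemma graded_basis_of_unitary_similar:
  assumes "A \<in> carrier_mat n n" "unitary_similar A M" "graded k ls M"
  obtains bs where "graded_basis A n k bs ls"
proof -
  obtain bs where "onb n (carrier_vec n) bs" "M = coord_mat A bs bs"
    using unitary_similarE[OF assms(1,2)] .
  thus ?thesis using that[of bs] assms by (simp add: graded_basis_def graded_basis_axioms_def square_mat_def)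
qed

lemma isometric_block_form_graded_basis:
  assumes A: "A \<in> carrier_mat n n" and k: "1 \<le> k" and form: "isometric_block_form A k d m As B C"
  obtains bs where "graded_basis A n k bs (block_levels d k m 1)"
proof -
  have "graded (Suc k - 1) (block_levels d k m 1) (superdiag_mat (map As [1..<k] @ [B]) C)"
  proof (rule graded_superdiag_mat)
    fix j assume "j \<in> {1..<k}"
    hence "j \<in> {1..k - 1}" by auto
    thus "As j \<in> carrier_mat (d j) (d (Suc j)) \<and> mat_adjoint (As j) * As j = 1\<^sub>m (d (Suc j))"
      using form by (auto simp: isometric_block_form_def)
  qed (use form k in \<open>auto simp: isometric_block_form_def\<close>)
  thus ?thesis
    using graded_basis_of_unitary_similar[OF A] form that by (auto simp: isometric_block_form_def)
qed

text \<open>The levels below \<open>j\<close> are those of the first \<open>j\<close> blocks, so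
  \<open>dim ker A^j = d 1 + ... + d j\<close>; differences give the sizes and rank-nullity gives
  \<open>m\<close>.\<close>

lemma isometric_block_form_kernel_block_sizes:
  assumes A: "A \<in> carrier_mat n n" and k: "1 \<le> k" and form: "isometric_block_form A k d m As B C"
  shows "kernel_block_sizes A k d m"
proof -
  obtain bs where "graded_basis A n k bs (block_levels d k m 1)"
    using isometric_block_form_graded_basis[OF assms] .
  then interpret graded_basis A n k bs "block_levels d k m 1" .
  have dim: "kernel_dim (A ^\<^sub>m j) = (\<Sum>t=1..j. d t)" if "j \<le> k" for j
    using kernel_dim_pow[OF that] length_filter_block_levels[OF that] by simp
  have "d 1 = kernel_dim A" using dim[OF k] A by simp
  moreover have "d j = kernel_dim (A ^\<^sub>m j) - kernel_dim (A ^\<^sub>m (j - 1))" if "j \<in> {2..k}" for j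
  proof -
    have "j = Suc (j - 1)" using that by simp
    then obtain i where i: "j = Suc i" ..
    thus ?thesis using dim[of j] dim[of "j - 1"] that by simp
  qed
  moreover have "m = vec_space.rank n (A ^\<^sub>m k)"
    using rank_nullity_mat[OF pow, of k] dim[of k] len(2) length_block_levels[of d k m] by simp
  ultimately show ?thesis using A by (auto simp: kernel_block_sizes_def)
qed

lemma isometric_block_form_partial_isometry:
  assumes "A \<in> carrier_mat n n" "1 \<le> k" "isometric_block_form A k d m As B C" "j \<le> k"
  shows "partial_isometry (A ^\<^sub>m j)"
  using isometric_block_form_graded_basis[OF assms(1-3)] graded_basis.partial_isometry_pow assms(4)
  by metis

lemma mat_adjoint_one: "mat_adjoint (1\<^sub>m n) = (1\<^sub>m n :: complex mat)"
  by (rule eq_matI) (auto simp: mat_adjoint_def mat_of_rows_index unit_vec_def)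

lemma jordan_block_form_partial_isometry:
  assumes A: "A \<in> carrier_mat n n" and k: "1 \<le> k" and form: "jordan_block_form A k d m B C" and j: "j \<le> k"
  shows "partial_isometry (A ^\<^sub>m j)"
proof -
  let ?X = "superdiag_mat (replicate (k - 1) (1\<^sub>m (d k)) @ [B]) C"
  let ?Js = "concat (map (\<lambda>j. replicate (d j - d (j + 1)) (jordan_block j 0)) (rev [1..<k]))"
  \<comment> \<open>The first summand is the matrix of form (b) with all block sizes equal to
    \<open>d k\<close> and identity blocks.\<close>
  have "graded (Suc k - 1) (block_levels (\<lambda>_. d k) k m 1) (superdiag_mat (map (\<lambda>_. 1\<^sub>m (d k)) [1..<k] @ [B]) C)"
    using form k by (intro graded_superdiag_mat) (auto simp: jordan_block_form_def mat_adjoint_one)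
  hence "graded k (block_levels (\<lambda>_. d k) k m 1) ?X" by (simp add: map_replicate_const)
  hence "\<exists>ls. graded k ls M" if "M \<in> set (?X # ?Js)" for M
    using that graded_jordan_block by auto
  then obtain ls where "graded k ls (diag_block_mat (?X # ?Js))"
    using graded_diag_block_mat by blast
  moreover have "unitary_similar A (diag_block_mat (?X # ?Js))"
    using form by (simp add: jordan_block_form_def)
  ultimately show ?thesis
    using graded_basis_of_unitary_similar[OF A] graded_basis.partial_isometry_pow j by metis
qed

theorem theorem2p2:
  fixes A :: "complex mat" and n l k :: nat
  assumes "A \<in> carrier_mat n n"
    and "ascent A \<ge> 1"
    and "l \<ge> 1"
    and "k = min l (ascent A)"
  shows "((\<forall>j \<in> {1..k}. partial_isometry (A ^\<^sub>m j)) \<longleftrightarrow>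
            (\<exists>d m As B C. isometric_block_form A k d m As B C)) \<and>
         ((\<forall>j \<in> {1..k}. partial_isometry (A ^\<^sub>m j)) \<longleftrightarrow>
            (\<exists>d m B C. jordan_block_form A k d m B C)) \<and>
         (\<forall>d m As B C. isometric_block_form A k d m As B C \<longrightarrow> kernel_block_sizes A k d m)"
proof -
  have k: "1 \<le> k" using assms by simp
  have "(\<exists>d m As B C. isometric_block_form A k d m As B C) \<and> (\<exists>d m B C. jordan_block_form A k d m B C)"
    if "\<forall>j \<in> {1..k}. partial_isometry (A ^\<^sub>m j)"
  proof -
    interpret partial_isometry_powers A n k
      using assms(1) k that by unfold_locales auto
    show ?thesis using isometric_block_form_E jordan_block_form_E by blast
  qed
  thus ?thesis
    using isometric_block_form_partial_isometry[OF assms(1) k]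
      jordan_block_form_partial_isometry[OF assms(1) k]
      isometric_block_form_kernel_block_sizes[OF assms(1) k]
    by (metis atLeastAtMost_iff)
qed

end
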